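(* For all integers $c,k$ with $1\le c\le k-1$, if $n$ is large enough, there are pairs of vertex-colored graphs $G,H$, each with $n$ vertices, that are distinguished by $k$-dimensional Weisfeiler--Leman, but such that $(k+c-1)$-dimensional Weisfeiler--Leman does not distinguish $G$ and $H$ in $t$ rounds for any $t<\bigl(2^{-(c+10)}k^{-3}n\bigr)^{k/(c+1)}$.
   Context: A vertex-colored graph is $G=(V,E,\mathrm{col})$ with $\mathrm{col}:V\to\mathbb{N}$. For $k\ge 2$, $k$-dimensional Weisfeiler--Leman computes colorings $\chi^{(i)}$ of $V^k$: $\chi^{(0)}(\vec u)$ is the isomorphism type of $\vec u=(u_1,\dots,u_k)$, where $(u_1,\dots,u_k)$ and $(v_1,\dots,v_k)$ have the same type iff $u_j\mapsto v_j$ preserves vertex colors and is an isomorphism between the induced subgraphs (including equalities). Then $\chi^{(i)}(\vec u)=\bigl(\chi^{(i-1)}(\vec u),\ \{\!\{(\chi^{(i-1)}(\vec u[v/u_1]),\dots,\chi^{(i-1)}(\vec u[v/u_k])) : v\in V\}\!\}\bigr)$, where $\vec u[v/u_j]$ replaces the $j$-th entry by $v$ and $\{\!\{\cdot\}\!\}$ is a multiset. The algorithm distinguishes $G$ and $H$ in $t$ rounds if for some color $\gamma$ the number of $k$-tuples of $G$ with $\chi^{(t)}$-color $\gamma$ differs from that for $H$ (colors computed by the same procedure on both graphs); it distinguishes $G$ and $H$ if it does so in some number of rounds. *)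

theory Defs
  imports Complex_Main "HOL-Library.Multiset" "Graph_Theory.Pair_Digraph"
begin

(* A vertex-colored graph is a pair_graph G (finite, symmetric, loopless arcs, i.e. a finite
   simple undirected graph) together with a coloring col, of which only the values on the
   vertices of G matter. *)
type_synonym 'a coloring = "'a \<Rightarrow> nat"

definition same_iso_type ::
  "'a pair_pre_digraph \<Rightarrow> 'a coloring \<Rightarrow> 'a list \<Rightarrow>
   'b pair_pre_digraph \<Rightarrow> 'b coloring \<Rightarrow> 'b list \<Rightarrow> bool" where
  "same_iso_type G colG us H colH vs \<longleftrightarrow>
     (\<exists>f. map f us = vs \<and> bij_betw f (set us) (set vs) \<and>
          (\<forall>x\<in>set us. colH (f x) = colG x) \<and>
          (\<forall>x\<in>set us. \<forall>y\<in>set us. (x, y) \<in> parcs G \<longleftrightarrow> (f x, f y) \<in> parcs H))"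

(* The WL colors are abstract values that do not mention the graph, so that the colors computed
   on different graphs can be compared. An isomorphism type is encoded by the vertex colors
   along the tuple, the pairs of positions carrying equal entries and the pairs of positions
   carrying adjacent entries; iso_type_eq_iff below shows that equality of these codes is
   exactly same_iso_type. *)
datatype wl_color =
    Iso_Type "nat list" "(nat \<times> nat) set" "(nat \<times> nat) set"
  | Refined wl_color "wl_color list multiset"

definition iso_type :: "'a pair_pre_digraph \<Rightarrow> 'a coloring \<Rightarrow> 'a list \<Rightarrow> wl_color" where
  "iso_type G col us = Iso_Type (map col us)
     {(i, j). i < length us \<and> j < length us \<and> us ! i = us ! j}
     {(i, j). i < length us \<and> j < length us \<and> (us ! i, us ! j) \<in> parcs G}"

lemma iso_type_eq_iff:
  "iso_type G colG us = iso_type H colH vs \<longleftrightarrow> same_iso_type G colG us H colH vs"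
proof
  assume eq: "iso_type G colG us = iso_type H colH vs"
  then have col: "map colG us = map colH vs" by (simp add: iso_type_def)
  then have len: "length us = length vs" by (metis length_map)
  have e: "us ! i = us ! j \<longleftrightarrow> vs ! i = vs ! j"
    and a: "(us ! i, us ! j) \<in> parcs G \<longleftrightarrow> (vs ! i, vs ! j) \<in> parcs H"
    if "i < length us" "j < length us" for i j
    using eq that len by (auto simp: iso_type_def set_eq_iff)
  define p where "p x = (SOME i. i < length us \<and> us ! i = x)" for x
  define f where "f x = vs ! p x" for x
  have p: "p x < length us \<and> us ! p x = x" if "x \<in> set us" for x
    unfolding p_def by (rule someI_ex) (use that in \<open>simp add: in_set_conv_nth\<close>)
  have f: "f (us ! i) = vs ! i" if "i < length us" for i
    using p[of "us ! i"] e[of "p (us ! i)" i] that by (simp add: f_def)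
  have mp: "map f us = vs"
    using f len by (simp add: list_eq_iff_nth_eq)
  moreover have "bij_betw f (set us) (set vs)"
  proof -
    have "inj_on f (set us)"
      using f e by (auto simp: inj_on_def in_set_conv_nth)
    then show ?thesis using mp by (auto simp: bij_betw_def)
  qed
  moreover have "\<forall>x\<in>set us. colH (f x) = colG x"
  proof
    fix x assume "x \<in> set us"
    then obtain i where i: "i < length us" "x = us ! i" by (auto simp: in_set_conv_nth)
    then have "colG (us ! i) = colH (vs ! i)"
      using arg_cong[OF col, of "\<lambda>l. l ! i"] len by simp
    then show "colH (f x) = colG x" using i f by simp
  qed
  moreover have "\<forall>x\<in>set us. \<forall>y\<in>set us. (x, y) \<in> parcs G \<longleftrightarrow> (f x, f y) \<in> parcs H"
    using a f by (auto simp: in_set_conv_nth)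
  ultimately show "same_iso_type G colG us H colH vs"
    unfolding same_iso_type_def by blast
next
  assume "same_iso_type G colG us H colH vs"
  then obtain f where f: "vs = map f us" "inj_on f (set us)"
      "\<forall>x\<in>set us. colH (f x) = colG x"
      "\<forall>x\<in>set us. \<forall>y\<in>set us. (x, y) \<in> parcs G \<longleftrightarrow> (f x, f y) \<in> parcs H"
    unfolding same_iso_type_def bij_betw_def by blast
  then show "iso_type G colG us = iso_type H colH vs"
    by (auto simp: iso_type_def inj_on_eq_iff)
qed

fun wl :: "'a pair_pre_digraph \<Rightarrow> 'a coloring \<Rightarrow> nat \<Rightarrow> 'a list \<Rightarrow> wl_color" where
  "wl G col 0 us = iso_type G col us"
| "wl G col (Suc i) us = Refined (wl G col i us)
     {# map (\<lambda>j. wl G col i (us[j := v])) [0..<length us]. v \<in># mset_set (pverts G) #}"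

definition tuples :: "nat \<Rightarrow> 'a set \<Rightarrow> 'a list set" where
  "tuples k V = {us. length us = k \<and> set us \<subseteq> V}"

definition wl_distinguishes_in ::
  "nat \<Rightarrow> nat \<Rightarrow> 'a pair_pre_digraph \<Rightarrow> 'a coloring \<Rightarrow>
   'b pair_pre_digraph \<Rightarrow> 'b coloring \<Rightarrow> bool" where
  "wl_distinguishes_in k t G colG H colH \<longleftrightarrow>
     (\<exists>\<gamma>. card {us \<in> tuples k (pverts G). wl G colG t us = \<gamma>} \<noteq>
          card {vs \<in> tuples k (pverts H). wl H colH t vs = \<gamma>})"

definition wl_distinguishes ::
  "nat \<Rightarrow> 'a pair_pre_digraph \<Rightarrow> 'a coloring \<Rightarrow>
   'b pair_pre_digraph \<Rightarrow> 'b coloring \<Rightarrow> bool" where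
  "wl_distinguishes k G colG H colH \<longleftrightarrow> (\<exists>t. wl_distinguishes_in k t G colG H colH)"

end

(* Proof idea: a system of linear equations over GF(2) gives two graphs, one for the homogeneous and
   one for the inhomogeneous right-hand sides: a vertex is an equation with a local solution, and two
   vertices are adjacent if their local solutions agree on the shared variables. The WL game on this
   pair is a pebble game in which Duplicator maintains a partial solution of the inhomogeneous system.
   The system is the Tseitin system of a cylinder with k rows whose row i is wrapped around modulo m i,
   with two gadgets (complete graphs on k equations) attached at columns 0 and L div 2. Each of
   the k pairwise coprime factors p l occurs in c + 1 cyclically consecutive moduli, so that L, the lcm of the moduli, is about
   the k-th power of a factor, while the moduli are only about its (c + 1)-st power. Spoiler wins with
   k + 1 pebbles by sweeping a cut of k pebbles from one gadget to the other. Against k + c pebbles, at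
   most c rows contain two pebbles or more; the remaining rows determine the position of a cut modulo L
   up to O(k), so a cut moves by O(k) per round, and Duplicator keeps the violated equation in the
   gadget far from it. If the pebbles form no cut, an explicit flow compatible with all the
   identifications carries the violated equation from one gadget to the other. *)

theory Submission
  imports Defs "HOL-Number_Theory.Cong"
begin

text \<open>A round in dimension d shows d pebbled equations and the one being placed, hence k + 1
  pebbles for Spoiler and k + c for Duplicator. Without the wrapping, L columns cost about L cells
  per row and buy only linearly many rounds; wrapping saves cells, and Spoiler, who checks parities
  locally, sweeps as if nothing were wrapped. The danger lies in shortcuts for Spoiler: a single row
  remembers little of the position of a cut, and a row with two pebbles nothing reliable. Since a
  factor lies in c + 1 rows, one of them still remembers it. These rows are consecutive because
  Duplicator's flow between two rows carrying \<open>p l\<close> crosses the rows in between, and a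
  flow of period \<open>p l\<close> is well defined only where \<open>p l\<close> divides the
  modulus. The remaining obstacle is that rows agree only up to O(k): errors varying with the
  modulus would be blown up by Chinese remaindering. The factor \<open>W\<close>, present in every
  modulus, ties these errors together.\<close>

lemma even_card_sym_diff:
  assumes "finite A" "finite B"
  shows "even (card (sym_diff A B)) \<longleftrightarrow> (even (card A) \<longleftrightarrow> even (card B))"
proof -
  have "card A = card (A \<inter> B) + card (A - B)" "card B = card (B \<inter> A) + card (B - A)"
    using assms by (simp_all add: card_Int_Diff)
  moreover have "B \<inter> A = A \<inter> B" by (rule Int_commute)
  moreover have "card (sym_diff A B) = card (A - B) + card (B - A)"
    using assms by (intro card_Un_disjoint) auto
  ultimately show ?thesis by auto
qed

section \<open>Weisfeiler--Leman colours under relabelling\<close>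

lemma finite_tuples: "finite V \<Longrightarrow> finite (tuples k V)"
  unfolding tuples_def using finite_lists_length_eq[of V k] by (simp add: conj_commute)

lemma tuples_update: "us \<in> tuples k V \<Longrightarrow> v \<in> V \<Longrightarrow> us[j := v] \<in> tuples k V"
  using set_update_subset_insert[of us j v] by (auto simp: tuples_def)

definition relabel_graph :: "('a \<Rightarrow> 'b) \<Rightarrow> 'a pair_pre_digraph \<Rightarrow> 'b pair_pre_digraph" where
  "relabel_graph f G = \<lparr>pverts = f ` pverts G, parcs = (\<lambda>(x, y). (f x, f y)) ` parcs G\<rparr>"

text \<open>Colors are abstract values, so an injective renaming preserves them. This is needed
  because the graphs are built on pairs of an equation and a local solution, whereas the theorem
  asks for natural numbers as vertices.\<close>

lemma wl_relabel:
  assumes inj: "inj_on f (pverts G)" and arcs: "parcs G \<subseteq> pverts G \<times> pverts G"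
    and col: "\<And>x. x \<in> pverts G \<Longrightarrow> col' (f x) = col x"
    and us: "set us \<subseteq> pverts G"
  shows "wl (relabel_graph f G) col' t (map f us) = wl G col t us"
  using us
proof (induction t arbitrary: us)
  case 0
  have mem: "us ! i \<in> pverts G" if "i < length us" for i
    using 0 that nth_mem by blast
  have "(f (us ! i), f (us ! j)) \<in> parcs (relabel_graph f G) \<longleftrightarrow> (us ! i, us ! j) \<in> parcs G"
    if "i < length us" "j < length us" for i j
  proof
    assume "(f (us ! i), f (us ! j)) \<in> parcs (relabel_graph f G)"
    then obtain x y where xy: "(x, y) \<in> parcs G" "f (us ! i) = f x" "f (us ! j) = f y"
      by (auto simp: relabel_graph_def)
    then have "us ! i = x" "us ! j = y"
      using arcs mem that inj by (auto dest!: inj_onD[OF inj])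
    then show "(us ! i, us ! j) \<in> parcs G" using xy by simp
  next
    assume "(us ! i, us ! j) \<in> parcs G"
    then show "(f (us ! i), f (us ! j)) \<in> parcs (relabel_graph f G)"
      by (force simp: relabel_graph_def)
  qed
  moreover have "f (us ! i) = f (us ! j) \<longleftrightarrow> us ! i = us ! j"
    if "i < length us" "j < length us" for i j
    using mem that inj_on_eq_iff[OF inj] by blast
  moreover have "map (col' \<circ> f) us = map col us"
    using 0 col by auto
  ultimately show ?case
    by (auto simp: iso_type_def)
next
  case (Suc t)
  have upd: "wl (relabel_graph f G) col' t ((map f us)[j := f v]) = wl G col t (us[j := v])"
    if "v \<in> pverts G" for j v
  proof -
    have "set (us[j := v]) \<subseteq> pverts G"
      using Suc.prems that set_update_subset_insert[of us j v] by auto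
    from Suc.IH[OF this] show ?thesis by (simp add: map_update)
  qed
  have "{# map (\<lambda>j. wl (relabel_graph f G) col' t ((map f us)[j := w])) [0..<length us].
        w \<in># mset_set (f ` pverts G) #} =
      {# map (\<lambda>j. wl (relabel_graph f G) col' t ((map f us)[j := f v])) [0..<length us].
        v \<in># mset_set (pverts G) #}"
    by (simp only: image_mset_mset_set[OF inj, symmetric] image_mset.compositionality comp_def)
  also have "\<dots> = {# map (\<lambda>j. wl G col t (us[j := v])) [0..<length us]. v \<in># mset_set (pverts G) #}"
  proof (rule image_mset_cong)
    fix v assume "v \<in># mset_set (pverts G)"
    then have "v \<in> pverts G" by (cases "finite (pverts G)") auto
    then show "map (\<lambda>j. wl (relabel_graph f G) col' t ((map f us)[j := f v])) [0..<length us] =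
        map (\<lambda>j. wl G col t (us[j := v])) [0..<length us]"
      using upd by simp
  qed
  finally show ?case
    using Suc by (simp add: relabel_graph_def)
qed

lemma card_wl_relabel:
  assumes inj: "inj_on f (pverts G)" and arcs: "parcs G \<subseteq> pverts G \<times> pverts G"
    and col: "\<And>x. x \<in> pverts G \<Longrightarrow> col' (f x) = col x"
  shows "card {us \<in> tuples k (pverts (relabel_graph f G)). wl (relabel_graph f G) col' t us = \<gamma>} =
    card {us \<in> tuples k (pverts G). wl G col t us = \<gamma>}"
proof -
  note wlr = wl_relabel[where f = f and G = G and col = col and col' = col', OF inj arcs col]
  have "{us \<in> tuples k (pverts (relabel_graph f G)). wl (relabel_graph f G) col' t us = \<gamma>} =
      map f ` {us \<in> tuples k (pverts G). wl G col t us = \<gamma>}" (is "?L = ?R")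
  proof
    show "?R \<subseteq> ?L"
    proof (rule image_subsetI)
      fix us assume "us \<in> {us \<in> tuples k (pverts G). wl G col t us = \<gamma>}"
      then show "map f us \<in> ?L"
        using wlr[of us t] by (auto simp: tuples_def relabel_graph_def)
    qed
    show "?L \<subseteq> ?R"
    proof
      fix vs assume vs: "vs \<in> ?L"
      then have "vs \<in> lists (f ` pverts G)"
        by (auto simp: tuples_def relabel_graph_def)
      then obtain us where us: "vs = map f us" "set us \<subseteq> pverts G"
        by (auto simp: lists_image)
      then show "vs \<in> ?R"
        using vs wlr[OF _ us(2), of t] by (auto simp: tuples_def)
    qed
  qed
  moreover have "inj_on (map f) {us \<in> tuples k (pverts G). wl G col t us = \<gamma>}"
  proof (rule inj_onI)
    fix us vs assume *: "us \<in> {us \<in> tuples k (pverts G). wl G col t us = \<gamma>}"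
      "vs \<in> {us \<in> tuples k (pverts G). wl G col t us = \<gamma>}" "map f us = map f vs"
    then have "inj_on f (set us \<union> set vs)"
      using inj_on_subset[OF inj] by (simp add: tuples_def)
    then show "us = vs" using map_inj_on *(3) by blast
  qed
  ultimately show ?thesis
    by (simp add: card_image)
qed

lemma wl_distinguishes_in_relabel:
  assumes "inj_on f (pverts G)" "parcs G \<subseteq> pverts G \<times> pverts G"
    and "inj_on h (pverts H)" "parcs H \<subseteq> pverts H \<times> pverts H"
    and "\<And>x. x \<in> pverts G \<Longrightarrow> colG' (f x) = colG x"
    and "\<And>x. x \<in> pverts H \<Longrightarrow> colH' (h x) = colH x"
  shows "wl_distinguishes_in k t (relabel_graph f G) colG' (relabel_graph h H) colH' \<longleftrightarrow>
    wl_distinguishes_in k t G colG H colH"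
  unfolding wl_distinguishes_in_def
  using card_wl_relabel[of f G colG' colG] card_wl_relabel[of h H colH' colH] assms by simp

section \<open>Colors at different numbers of rounds\<close>

lemma wl_eq_mono:
  assumes "wl G colG s us = wl H colH s vs" "t \<le> s"
  shows "wl G colG t us = wl H colH t vs"
  using assms by (induction s) (auto simp: le_Suc_eq)

text \<open>Compactness: an answer of Duplicator may depend on the number of rounds, but there are
  finitely many answers and equivalence for more rounds implies it for fewer, so one answer works
  for all rounds.\<close>

lemma finite_eventually_all:
  fixes P :: "nat \<Rightarrow> 'a \<Rightarrow> bool"
  assumes fin: "finite A" and ex: "\<And>t. \<exists>x\<in>A. P t x"
    and mono: "\<And>s t x. P s x \<Longrightarrow> t \<le> s \<Longrightarrow> P t x"
  shows "\<exists>x\<in>A. \<forall>t. P t x"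
proof (rule ccontr)
  assume "\<not> ?thesis"
  then have "\<forall>x\<in>A. \<exists>t. \<not> P t x" by blast
  then obtain T where T: "\<And>x. x \<in> A \<Longrightarrow> \<not> P (T x) x" by metis
  obtain x where x: "x \<in> A" "P (Max (T ` A)) x" using ex by blast
  have "T x \<le> Max (T ` A)" using x fin by simp
  then show False using mono x T by blast
qed

section \<open>Graphs of parity systems\<close>

locale parity_system =
  fixes B :: "'b set" and N :: "'b \<Rightarrow> 'v set" and \<tau> :: "'b \<Rightarrow> bool" and bcol :: "'b \<Rightarrow> nat"
  assumes finite_B: "finite B" and finite_N: "\<And>b. finite (N b)" and inj_bcol: "inj_on bcol B"
begin

definition sat :: "'v set \<Rightarrow> 'b \<Rightarrow> bool" where
  "sat f b \<longleftrightarrow> (odd (card (f \<inter> N b)) \<longleftrightarrow> \<tau> b)"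

definition verts_of :: "('b \<Rightarrow> bool) \<Rightarrow> ('b \<times> 'v set) set" where
  "verts_of \<sigma> = (SIGMA b:B. {x. x \<subseteq> N b \<and> (odd (card x) \<longleftrightarrow> \<sigma> b)})"

definition graph_of :: "('b \<Rightarrow> bool) \<Rightarrow> ('b \<times> 'v set) pair_pre_digraph" where
  "graph_of \<sigma> = \<lparr>pverts = verts_of \<sigma>,
     parcs = {(u, v). u \<in> verts_of \<sigma> \<and> v \<in> verts_of \<sigma> \<and> fst u \<noteq> fst v \<and>
       snd u \<inter> N (fst v) = snd v \<inter> N (fst u)}\<rparr>"

abbreviation "G \<equiv> graph_of (\<lambda>_. False)"
abbreviation "H \<equiv> graph_of \<tau>"

text \<open>As \<open>bcol\<close> is injective on \<open>B\<close>, the color names the equation,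
  and corresponding vertices always belong to the same equation.\<close>

definition vcol :: "'b \<times> 'v set \<Rightarrow> nat" where
  "vcol u = bcol (fst u)"

lemma pverts_graph_of [simp]: "pverts (graph_of \<sigma>) = verts_of \<sigma>"
  by (simp add: graph_of_def)

lemma parcs_graph_of_iff:
  "(u, v) \<in> parcs (graph_of \<sigma>) \<longleftrightarrow> u \<in> verts_of \<sigma> \<and> v \<in> verts_of \<sigma> \<and> fst u \<noteq> fst v \<and>
     snd u \<inter> N (fst v) = snd v \<inter> N (fst u)"
  by (simp add: graph_of_def)

lemma parcs_graph_of_subset: "parcs (graph_of \<sigma>) \<subseteq> pverts (graph_of \<sigma>) \<times> pverts (graph_of \<sigma>)"
  by (auto simp: graph_of_def)

lemma finite_verts_of: "finite (verts_of \<sigma>)"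
  unfolding verts_of_def using finite_B finite_N by (intro finite_SigmaI) auto

text \<open>Adding \<open>f\<close> over GF(2) to a local solution. This involution is Duplicator's
  correspondence: it preserves agreement, hence adjacency, for every \<open>f\<close>, and it
  exchanges the two vertex sets at each equation that \<open>f\<close> satisfies.\<close>

definition shift :: "'v set \<Rightarrow> 'b \<times> 'v set \<Rightarrow> 'b \<times> 'v set" where
  "shift f u = (fst u, sym_diff (snd u) (f \<inter> N (fst u)))"

lemma fst_shift [simp]: "fst (shift f u) = fst u"
  by (simp add: shift_def)

lemma shift_shift [simp]: "shift f (shift f u) = u"
  by (cases u) (auto simp: shift_def)

lemma shift_inj: "shift f u = shift f v \<longleftrightarrow> u = v"
  by (metis shift_shift)

lemma shift_verts:
  assumes "sat f (fst u)"
  shows "shift f u \<in> verts_of \<tau> \<longleftrightarrow> u \<in> verts_of (\<lambda>_. False)"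
proof -
  obtain b x where u: "u = (b, x)" by fastforce
  have "x \<subseteq> N b \<Longrightarrow> finite x" using finite_N finite_subset by blast
  then have "x \<subseteq> N b \<Longrightarrow> odd (card (sym_diff x (f \<inter> N b))) \<longleftrightarrow> (odd (card x) \<longleftrightarrow> \<not> \<tau> b)"
    using even_card_sym_diff[of x "f \<inter> N b"] finite_N assms by (auto simp: sat_def u)
  moreover have "sym_diff x (f \<inter> N b) \<subseteq> N b \<longleftrightarrow> x \<subseteq> N b" by auto
  ultimately show ?thesis
    unfolding verts_of_def shift_def u by auto
qed

lemma shift_agree:
  "snd (shift f u) \<inter> N (fst v) = snd (shift f v) \<inter> N (fst u) \<longleftrightarrow>
     snd u \<inter> N (fst v) = snd v \<inter> N (fst u)"
proof -
  have "snd (shift f u) \<inter> N (fst v) = sym_diff (snd u \<inter> N (fst v)) (f \<inter> N (fst u) \<inter> N (fst v))"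
    by (auto simp: shift_def)
  moreover have "snd (shift f v) \<inter> N (fst u) = sym_diff (snd v \<inter> N (fst u)) (f \<inter> N (fst u) \<inter> N (fst v))"
    by (auto simp: shift_def)
  moreover have "sym_diff X Z = sym_diff Y Z \<longleftrightarrow> X = Y" for X Y Z :: "'v set" by auto
  ultimately show ?thesis by simp
qed

lemma shift_cong: "f \<inter> N (fst u) = f' \<inter> N (fst u) \<Longrightarrow> shift f u = shift f' u"
  by (simp add: shift_def)

subsection \<open>Duplicator\<close>

text \<open>\<open>P r S f\<close> is a position of Duplicator with pebbled equations
  \<open>S\<close>, partial solution \<open>f\<close> and \<open>r\<close> rounds left. The answer
  to a vertex depends only on its equation \<open>b\<close>, through one assignment
  \<open>F b\<close> agreeing with \<open>f\<close> at \<open>S\<close>. Hence the answers form a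
  bijection of the vertex sets, and pebbled vertices keep their partners.\<close>

lemma wl_shift_eq:
  assumes sat: "\<And>r S f b. P r S f \<Longrightarrow> b \<in> S \<Longrightarrow> sat f b"
    and step: "\<And>r S f b. P (Suc r) S f \<Longrightarrow> S \<subseteq> B \<Longrightarrow> card S \<le> d \<Longrightarrow> b \<in> B \<Longrightarrow>
      \<exists>f'. (\<forall>b'\<in>S. f' \<inter> N b' = f \<inter> N b') \<and> P r (insert b S) f'"
    and mono: "\<And>r S S' f. P r S f \<Longrightarrow> S' \<subseteq> S \<Longrightarrow> P r S' f"
    and P: "P r (fst ` set us) f" and us: "us \<in> tuples d (verts_of (\<lambda>_. False))" and d: "0 < d"
  shows "wl G vcol r us = wl H vcol r (map (shift f) us)"
  using P us
proof (induction r arbitrary: us f)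
  case 0
  have mem: "us ! i \<in> verts_of (\<lambda>_. False)" if "i < d" for i
    using 0(2) that by (auto simp: tuples_def)
  have mem': "shift f (us ! i) \<in> verts_of \<tau>" if "i < d" for i
    using 0(2) that mem sat[OF 0(1)] by (subst shift_verts) (auto simp: tuples_def)
  have "(shift f (us ! i), shift f (us ! j)) \<in> parcs H \<longleftrightarrow> (us ! i, us ! j) \<in> parcs G"
    if "i < d" "j < d" for i j
    using mem mem' that shift_agree by (simp add: parcs_graph_of_iff)
  moreover have "length us = d" using 0(2) by (simp add: tuples_def)
  moreover have "map (vcol \<circ> shift f) us = map vcol us" by (auto simp: vcol_def)
  ultimately show ?case
    by (auto simp: iso_type_def shift_inj)
next
  case (Suc r)
  let ?S = "fst ` set us"
  have len: "length us = d" and set: "set us \<subseteq> verts_of (\<lambda>_. False)"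
    using Suc.prems by (auto simp: tuples_def)
  have SB: "?S \<subseteq> B" using set by (auto simp: verts_of_def)
  have cS: "card ?S \<le> d" using len card_length[of us] card_image_le[of "set us" fst] by simp
  have "\<exists>f'. (\<forall>b'\<in>?S. f' \<inter> N b' = f \<inter> N b') \<and> P r (insert b ?S) f'" if "b \<in> B" for b
    using step[OF Suc.prems(1) SB cS that] .
  then obtain F where F: "\<And>b b'. b \<in> B \<Longrightarrow> b' \<in> ?S \<Longrightarrow> F b \<inter> N b' = f \<inter> N b'"
      "\<And>b. b \<in> B \<Longrightarrow> P r (insert b ?S) (F b)"
    by metis
  define g where "g v = shift (F (fst v)) v" for v
  have upd: "wl G vcol r (us[j := v]) = wl H vcol r ((map (shift f) us)[j := g v])"
    if v: "v \<in> verts_of (\<lambda>_. False)" for j v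
  proof -
    let ?b = "fst v"
    have b: "?b \<in> B" using v by (auto simp: verts_of_def)
    have "fst ` set (us[j := v]) \<subseteq> insert ?b ?S"
      using set_update_subset_insert[of us j v] by auto
    then have "P r (fst ` set (us[j := v])) (F ?b)" using mono[OF F(2)[OF b]] by blast
    from Suc.IH[OF this tuples_update[OF Suc.prems(2) v]]
    have "wl G vcol r (us[j := v]) = wl H vcol r (map (shift (F ?b)) (us[j := v]))" .
    also have "map (shift (F ?b)) (us[j := v]) = (map (shift (F ?b)) us)[j := g v]"
      by (simp add: map_update g_def)
    also have "map (shift (F ?b)) us = map (shift f) us"
      using F(1)[OF b] by (auto intro!: shift_cong)
    finally show ?thesis .
  qed
  have "us \<noteq> []" using len d by auto
  then have u0: "us ! 0 \<in> verts_of (\<lambda>_. False)" "fst (us ! 0) \<in> ?S" using set by auto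
  \<comment> \<open>The color of the unchanged tuple at round \<open>r\<close> comes from replacing
    entry 0 by itself.\<close>
  have first: "wl G vcol r us = wl H vcol r (map (shift f) us)"
    using upd[OF u0(1), of 0] F(1)[of "fst (us ! 0)", OF _ u0(2)] SB u0(2) \<open>us \<noteq> []\<close>
    by (simp add: g_def shift_cong[of "F (fst (us ! 0))" "us ! 0" f] subset_iff
        list_update_same_conv[THEN iffD2])
  have satF: "sat (F (fst v)) (fst v)" if "fst v \<in> B" for v :: "'b \<times> 'v set"
    using sat[OF F(2)[OF that]] by simp
  have gg: "g (g v) = v" for v by (simp add: g_def)
  have "bij_betw g (verts_of (\<lambda>_. False)) (verts_of \<tau>)"
  proof (rule bij_betw_byWitness[where f' = g])
    show "g ` verts_of (\<lambda>_. False) \<subseteq> verts_of \<tau>"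
    proof (rule image_subsetI)
      fix v assume v: "v \<in> verts_of (\<lambda>_. False)"
      then have "fst v \<in> B" by (auto simp: verts_of_def)
      from shift_verts[OF satF[OF this]] v
      show "g v \<in> verts_of \<tau>" by (simp add: g_def)
    qed
    show "g ` verts_of \<tau> \<subseteq> verts_of (\<lambda>_. False)"
    proof (rule image_subsetI)
      fix v assume v: "v \<in> verts_of \<tau>"
      then have b: "fst v \<in> B" by (auto simp: verts_of_def)
      have "shift (F (fst v)) (g v) \<in> verts_of \<tau>" using v by (simp add: g_def)
      then show "g v \<in> verts_of (\<lambda>_. False)"
        using shift_verts[of "F (fst v)" "g v"] satF[OF b] by (simp add: g_def)
    qed
  qed (use gg in auto)
  then have "mset_set (verts_of \<tau>) = image_mset g (mset_set (verts_of (\<lambda>_. False)))"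
    by (auto simp: bij_betw_def image_mset_mset_set)
  then have "{# map (\<lambda>j. wl H vcol r ((map (shift f) us)[j := w])) [0..<length us].
        w \<in># mset_set (pverts H) #} =
      {# map (\<lambda>j. wl G vcol r (us[j := v])) [0..<length us]. v \<in># mset_set (pverts G) #}"
    using upd finite_verts_of
    by (auto simp: image_mset.compositionality comp_def intro!: image_mset_cong)
  then show ?case using first by simp
qed

text \<open>The assignment used for a tuple depends only on its set of equations, which the shift
  leaves unchanged. So the map on tuples is an involution and matches the color classes of both
  graphs.\<close>

lemma not_wl_distinguishes_in:
  assumes sat: "\<And>r S f b. P r S f \<Longrightarrow> b \<in> S \<Longrightarrow> sat f b"
    and step: "\<And>r S f b. P (Suc r) S f \<Longrightarrow> S \<subseteq> B \<Longrightarrow> card S \<le> d \<Longrightarrow> b \<in> B \<Longrightarrow>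
      \<exists>f'. (\<forall>b'\<in>S. f' \<inter> N b' = f \<inter> N b') \<and> P r (insert b S) f'"
    and mono: "\<And>r S S' f. P r S f \<Longrightarrow> S' \<subseteq> S \<Longrightarrow> P r S' f"
    and init: "\<And>S. S \<subseteq> B \<Longrightarrow> card S \<le> d \<Longrightarrow> \<exists>f. P r S f" and d: "0 < d"
  shows "\<not> wl_distinguishes_in d r G vcol H vcol"
proof -
  obtain F where F: "\<And>S. S \<subseteq> B \<Longrightarrow> card S \<le> d \<Longrightarrow> P r S (F S)" using init by metis
  define g where "g us = map (shift (F (fst ` set us))) us" for us
  have fst_g: "fst ` set (g us) = fst ` set us" for us
    by (auto simp: g_def image_image)
  have gg: "g (g us) = us" for us
    using fst_g[of us] by (simp add: g_def comp_def)
  have P: "P r (fst ` set us) (F (fst ` set us))" if "us \<in> tuples d (verts_of \<sigma>)" for us \<sigma>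
  proof (rule F)
    show "fst ` set us \<subseteq> B" using that by (auto simp: tuples_def verts_of_def)
    show "card (fst ` set us) \<le> d"
      using that card_length[of us] card_image_le[of "set us" fst] by (simp add: tuples_def)
  qed
  have GH: "g us \<in> tuples d (verts_of \<tau>)" if us: "us \<in> tuples d (verts_of (\<lambda>_. False))" for us
  proof -
    have "shift (F (fst ` set us)) u \<in> verts_of \<tau>" if "u \<in> set us" for u
      using sat[OF P[OF us]] us that by (subst shift_verts) (auto simp: tuples_def)
    then show ?thesis using us by (auto simp: tuples_def g_def)
  qed
  have HG: "g us \<in> tuples d (verts_of (\<lambda>_. False))" if us: "us \<in> tuples d (verts_of \<tau>)" for us
  proof -
    have "shift (F (fst ` set us)) u \<in> verts_of (\<lambda>_. False)" if "u \<in> set us" for u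
      using sat[OF P[OF us]] us that by (subst shift_verts[symmetric, where f = "F (fst ` set us)"])
        (auto simp: tuples_def)
    then show ?thesis using us by (auto simp: tuples_def g_def)
  qed
  have wl: "wl G vcol r us = wl H vcol r (g us)" if us: "us \<in> tuples d (verts_of (\<lambda>_. False))" for us
    unfolding g_def by (rule wl_shift_eq[of P, OF sat step mono P[OF us] us d]) assumption+
  have "card {us \<in> tuples d (verts_of (\<lambda>_. False)). wl G vcol r us = \<gamma>} =
      card {us \<in> tuples d (verts_of \<tau>). wl H vcol r us = \<gamma>}" for \<gamma>
  proof (rule bij_betw_same_card, rule bij_betw_byWitness[where f = g and f' = g])
    show "g ` {us \<in> tuples d (verts_of \<tau>). wl H vcol r us = \<gamma>}
        \<subseteq> {us \<in> tuples d (verts_of (\<lambda>_. False)). wl G vcol r us = \<gamma>}"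
      using HG wl gg by auto
    show "g ` {us \<in> tuples d (verts_of (\<lambda>_. False)). wl G vcol r us = \<gamma>}
        \<subseteq> {us \<in> tuples d (verts_of \<tau>). wl H vcol r us = \<gamma>}"
      using GH wl by auto
  qed (use gg in auto)
  then show ?thesis by (simp add: wl_distinguishes_in_def)
qed

subsection \<open>Spoiler\<close>

text \<open>Spoiler pebbles zero solutions only. Those of distinct equations are adjacent, which
  forces the answers to agree on shared variables, so that they are the restrictions of one
  assignment \<open>f\<close>. Asking for all \<open>t\<close> at once removes the round
  counter.\<close>

definition reach :: "'b list \<Rightarrow> 'v set \<Rightarrow> bool" where
  "reach bs f \<longleftrightarrow> (\<forall>b\<in>set bs. sat f b) \<and>
     (\<forall>t. wl G vcol t (map (\<lambda>b. (b, {})) bs) = wl H vcol t (map (\<lambda>b. (b, f \<inter> N b)) bs))"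

lemma zero_vert: "b \<in> B \<Longrightarrow> (b, {}) \<in> verts_of (\<lambda>_. False)"
  by (simp add: verts_of_def)

lemma wl_eq_zero_tupleD:
  assumes eq: "wl G vcol t (map (\<lambda>b. (b, {})) bs) = wl H vcol t vs"
    and bs: "set bs \<subseteq> B" and vs: "set vs \<subseteq> verts_of \<tau>"
  shows "length vs = length bs" "map fst vs = bs"
    "\<And>i j. i < length bs \<Longrightarrow> j < length bs \<Longrightarrow> snd (vs ! i) \<inter> N (bs ! j) = snd (vs ! j) \<inter> N (bs ! i)"
proof -
  have eq0: "iso_type G vcol (map (\<lambda>b. (b, {})) bs) = iso_type H vcol vs"
    using wl_eq_mono[OF eq, of 0] by simp
  then have col: "map bcol bs = map vcol vs" by (simp add: iso_type_def comp_def vcol_def)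
  then show len: "length vs = length bs" by (metis length_map)
  have "set (map fst vs) \<subseteq> B" using vs by (auto simp: verts_of_def)
  moreover have "map bcol bs = map bcol (map fst vs)" using col by (simp add: vcol_def)
  ultimately show fsts: "map fst vs = bs"
    using map_inj_on[of bcol bs "map fst vs"] inj_on_subset[OF inj_bcol] bs by auto
  fix i j assume ij: "i < length bs" "j < length bs"
  have fst_vs: "fst (vs ! i) = bs ! i" if "i < length bs" for i
    using fsts that len by (metis nth_map)
  show "snd (vs ! i) \<inter> N (bs ! j) = snd (vs ! j) \<inter> N (bs ! i)"
  proof (cases "bs ! i = bs ! j")
    case True
    have "{(i, j). i < length bs \<and> j < length bs \<and>
          map (\<lambda>b. (b, {} :: 'v set)) bs ! i = map (\<lambda>b. (b, {})) bs ! j} =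
        {(i, j). i < length bs \<and> j < length bs \<and> vs ! i = vs ! j}"
      using eq0 len by (simp add: iso_type_def)
    moreover have "(i, j) \<in> {(i, j). i < length bs \<and> j < length bs \<and>
          map (\<lambda>b. (b, {} :: 'v set)) bs ! i = map (\<lambda>b. (b, {})) bs ! j}"
      using True ij by simp
    ultimately have "vs ! i = vs ! j" by auto
    then show ?thesis using True by simp
  next
    case False
    have "{(i, j). i < length bs \<and> j < length bs \<and>
          (map (\<lambda>b. (b, {})) bs ! i, map (\<lambda>b. (b, {})) bs ! j) \<in> parcs G} =
        {(i, j). i < length bs \<and> j < length bs \<and> (vs ! i, vs ! j) \<in> parcs H}"
      using eq0 len by (simp add: iso_type_def)
    moreover have "(i, j) \<in> {(i, j). i < length bs \<and> j < length bs \<and>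
          (map (\<lambda>b. (b, {})) bs ! i, map (\<lambda>b. (b, {})) bs ! j) \<in> parcs G}"
      using False ij subsetD[OF bs nth_mem] zero_vert by (simp add: parcs_graph_of_iff)
    ultimately have "(vs ! i, vs ! j) \<in> parcs H" by auto
    then show ?thesis using fst_vs ij by (simp add: parcs_graph_of_iff)
  qed
qed

lemma reach_init:
  assumes nd: "\<not> wl_distinguishes k G vcol H vcol" and bs: "set bs \<subseteq> B" "length bs = k"
  shows "\<exists>f. reach bs f"
proof -
  let ?us = "map (\<lambda>b. (b, {} :: 'v set)) bs"
  have us: "?us \<in> tuples k (verts_of (\<lambda>_. False))"
    using bs zero_vert by (auto simp: tuples_def)
  have ex: "\<exists>vs\<in>tuples k (verts_of \<tau>). wl G vcol t ?us = wl H vcol t vs" for t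
  proof -
    let ?\<gamma> = "wl G vcol t ?us"
    have "card {us \<in> tuples k (verts_of (\<lambda>_. False)). wl G vcol t us = ?\<gamma>} =
        card {vs \<in> tuples k (verts_of \<tau>). wl H vcol t vs = ?\<gamma>}"
      using nd unfolding wl_distinguishes_def wl_distinguishes_in_def pverts_graph_of by blast
    moreover have "card {us \<in> tuples k (verts_of (\<lambda>_. False)). wl G vcol t us = ?\<gamma>} \<noteq> 0" (is "card ?A \<noteq> 0")
    proof -
      have "finite {us \<in> tuples k (verts_of (\<lambda>_. False)). wl G vcol t us = ?\<gamma>}"
        using finite_tuples[OF finite_verts_of] by simp
      moreover have "?us \<in> ?A" using us by blast
      ultimately show ?thesis by (auto simp only: card_0_eq)
    qed
    ultimately have "{vs \<in> tuples k (verts_of \<tau>). wl H vcol t vs = ?\<gamma>} \<noteq> {}"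
      by (metis card.empty)
    then obtain vs where "vs \<in> {vs \<in> tuples k (verts_of \<tau>). wl H vcol t vs = ?\<gamma>}" by blast
    then have "vs \<in> tuples k (verts_of \<tau>)" "?\<gamma> = wl H vcol t vs" by simp_all
    then show ?thesis by blast
  qed
  have "\<exists>vs\<in>tuples k (verts_of \<tau>). \<forall>t. wl G vcol t ?us = wl H vcol t vs"
    by (rule finite_eventually_all[OF finite_tuples[OF finite_verts_of] ex]) (rule wl_eq_mono)
  then obtain vs where vs: "vs \<in> tuples k (verts_of \<tau>)"
      and wl: "\<And>t. wl G vcol t ?us = wl H vcol t vs" by blast
  have set_vs: "set vs \<subseteq> verts_of \<tau>" using vs by (simp add: tuples_def)
  note * = wl_eq_zero_tupleD[OF wl bs(1) set_vs]
  \<comment> \<open>Because the answers agree pairwise on shared variables, their union restricts to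
    each of them.\<close>
  define f where "f = \<Union> (snd ` set vs)"
  have f: "f \<inter> N (bs ! i) = snd (vs ! i)" if i: "i < length bs" for i
  proof
    have mem: "vs ! i \<in> set vs" using i *(1) by simp
    then have "vs ! i \<in> verts_of \<tau>" using set_vs by blast
    then have "snd (vs ! i) \<subseteq> N (fst (vs ! i))" by (auto simp: verts_of_def)
    moreover have "fst (vs ! i) = bs ! i" using *(1,2) i by (metis nth_map)
    ultimately show "snd (vs ! i) \<subseteq> f \<inter> N (bs ! i)"
      using mem by (auto simp: f_def)
    show "f \<inter> N (bs ! i) \<subseteq> snd (vs ! i)"
    proof
      fix x assume "x \<in> f \<inter> N (bs ! i)"
      then obtain j where "j < length bs" "x \<in> snd (vs ! j) \<inter> N (bs ! i)"
        using *(1) by (auto simp: f_def in_set_conv_nth)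
      then show "x \<in> snd (vs ! i)" using *(3)[OF i, of j] by blast
    qed
  qed
  have vs_eq: "map (\<lambda>b. (b, f \<inter> N b)) bs = vs"
  proof (rule nth_equalityI)
    fix i assume "i < length (map (\<lambda>b. (b, f \<inter> N b)) bs)"
    then have i: "i < length bs" by simp
    then have "fst (vs ! i) = bs ! i" using *(1,2) by (metis nth_map)
    then show "map (\<lambda>b. (b, f \<inter> N b)) bs ! i = vs ! i" using i f by (simp add: prod_eq_iff)
  qed (use *(1) in simp)
  have "sat f b" if "b \<in> set bs" for b
  proof -
    have "(b, f \<inter> N b) \<in> set vs" using that by (subst vs_eq[symmetric]) auto
    then have "(b, f \<inter> N b) \<in> verts_of \<tau>" using set_vs by blast
    then show ?thesis by (simp add: verts_of_def sat_def)
  qed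
  then show ?thesis using wl vs_eq by (auto simp: reach_def)
qed

text \<open>The multiset of the next round records the lists over all positions, so a single answer
  \<open>w\<close> to the new equation serves every position that may be overwritten.\<close>

lemma reach_step:
  assumes reach: "reach bs f" and bs: "set bs \<subseteq> B" "2 \<le> length bs" and b: "b \<in> B"
  shows "\<exists>f'. (\<forall>b'\<in>set bs. f' \<inter> N b' = f \<inter> N b') \<and> sat f' b \<and> (\<forall>i<length bs. reach (bs[i := b]) f')"
proof -
  let ?us = "map (\<lambda>b. (b, {} :: 'v set)) bs" and ?vs = "map (\<lambda>b. (b, f \<inter> N b)) bs"
  let ?v = "(b, {} :: 'v set)"
  have vs_H: "set ?vs \<subseteq> verts_of \<tau>"
    using reach bs by (auto simp: reach_def verts_of_def sat_def)
  have ex: "\<exists>w\<in>verts_of \<tau>. \<forall>i<length bs. wl G vcol t (?us[i := ?v]) = wl H vcol t (?vs[i := w])" for t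
  proof -
    have "wl G vcol (Suc t) ?us = wl H vcol (Suc t) ?vs" using reach by (simp only: reach_def)
    then have eq: "{# map (\<lambda>j. wl G vcol t (?us[j := v])) [0..<length bs]. v \<in># mset_set (verts_of (\<lambda>_. False)) #} =
        {# map (\<lambda>j. wl H vcol t (?vs[j := v])) [0..<length bs]. v \<in># mset_set (verts_of \<tau>) #}"
      by simp
    have "map (\<lambda>j. wl G vcol t (?us[j := ?v])) [0..<length bs] \<in>#
        {# map (\<lambda>j. wl G vcol t (?us[j := v])) [0..<length bs]. v \<in># mset_set (verts_of (\<lambda>_. False)) #}"
      using zero_vert[OF b] finite_verts_of by auto
    then obtain w where "w \<in> verts_of \<tau>"
        "map (\<lambda>j. wl G vcol t (?us[j := ?v])) [0..<length bs] = map (\<lambda>j. wl H vcol t (?vs[j := w])) [0..<length bs]"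
      unfolding eq using finite_verts_of by auto
    then show ?thesis by auto
  qed
  have "\<exists>w\<in>verts_of \<tau>. \<forall>t. \<forall>i<length bs. wl G vcol t (?us[i := ?v]) = wl H vcol t (?vs[i := w])"
    by (rule finite_eventually_all[OF finite_verts_of ex]) (blast intro: wl_eq_mono)
  then obtain w where w: "w \<in> verts_of \<tau>"
      and wl: "\<And>t i. i < length bs \<Longrightarrow> wl G vcol t (?us[i := ?v]) = wl H vcol t (?vs[i := w])"
    by blast
  have wl': "wl G vcol t (map (\<lambda>b. (b, {})) (bs[i := b])) = wl H vcol t (?vs[i := w])"
    if "i < length bs" for t i
    using wl[OF that] by (simp add: map_update)
  have bs': "set (bs[i := b]) \<subseteq> B" for i
    using bs b set_update_subset_insert[of bs i b] by auto
  have vs': "set (?vs[i := w]) \<subseteq> verts_of \<tau>" for i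
    using vs_H w set_update_subset_insert[of ?vs i w] by blast
  note * = wl_eq_zero_tupleD[OF wl' bs' vs']
  have fst_w: "fst w = b"
  proof -
    have "0 < length bs" using bs by linarith
    from *(2)[OF this] have "map fst (?vs[0 := w]) ! 0 = bs[0 := b] ! 0" by simp
    then show ?thesis using \<open>0 < length bs\<close> by simp
  qed
  define d where "d = snd w"
  have w_eq: "w = (b, d)" using fst_w by (simp add: d_def prod_eq_iff)
  have d: "d \<subseteq> N b" "odd (card d) \<longleftrightarrow> \<tau> b" using w by (auto simp: w_eq verts_of_def)
  have agree: "d \<inter> N b' = f \<inter> N b' \<inter> N b" if b': "b' \<in> set bs" for b'
  proof -
    obtain i where i: "i < length bs" "bs ! i = b'" using b' by (auto simp: in_set_conv_nth)
    \<comment> \<open>To compare the answer with entry \<open>i\<close>, the new vertex is put at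
      another position \<open>j\<close>; this is where two positions are needed.\<close>
    have "\<exists>j<length bs. j \<noteq> i"
      using bs(2) by (intro exI[of _ "if i = 0 then 1 else 0"], cases "i = 0") (linarith | auto)+
    then obtain j where j: "j < length bs" "j \<noteq> i" by blast
    show ?thesis using *(3)[OF j(1), of j i] i j by (auto simp: w_eq)
  qed
  define f' where "f' = (f - N b) \<union> d"
  have f'_bs: "f' \<inter> N b' = f \<inter> N b'" if "b' \<in> set bs" for b'
    using agree[OF that] d by (auto simp: f'_def)
  have f'_b: "f' \<inter> N b = d" using d by (auto simp: f'_def)
  have sat_b: "sat f' b" using d by (simp add: sat_def f'_b)
  have "reach (bs[i := b]) f'" if i: "i < length bs" for i
    unfolding reach_def
  proof (intro conjI ballI allI)
    fix b' assume "b' \<in> set (bs[i := b])"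
    then have "b' = b \<or> b' \<in> set bs" using set_update_subset_insert[of bs i b] by auto
    then show "sat f' b'"
      using sat_b reach f'_bs by (auto simp: reach_def sat_def)
  next
    fix t
    have "map (\<lambda>b. (b, f' \<inter> N b)) (bs[i := b]) = ?vs[i := w]"
      using f'_bs by (simp add: map_update f'_b w_eq) (metis (no_types, lifting) map_eq_conv)
    then show "wl G vcol t (map (\<lambda>b. (b, {})) (bs[i := b])) =
        wl H vcol t (map (\<lambda>b. (b, f' \<inter> N b)) (bs[i := b]))"
      using wl'[OF i] by simp
  qed
  then show ?thesis using f'_bs sat_b by blast
qed

subsection \<open>The vertex sets\<close>

text \<open>Flipping one fixed variable of an equation exchanges its even and its odd local
  solutions.\<close>

lemma card_verts_of_eq:
  assumes ne: "\<And>b. b \<in> B \<Longrightarrow> N b \<noteq> {}"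
  shows "card (verts_of \<sigma>) = card (verts_of \<sigma>')"
proof -
  define e where "e b = (SOME x. x \<in> N b)" for b
  have e: "e b \<in> N b" if "b \<in> B" for b
    using ne[OF that] by (simp add: e_def some_in_eq)
  define g where "g u = (fst u, if \<sigma> (fst u) = \<sigma>' (fst u) then snd u else sym_diff (snd u) {e (fst u)})" for u
  have gg: "g (g u) = u" for u by (auto simp: g_def prod_eq_iff)
  have mem: "g u \<in> verts_of \<rho> \<longleftrightarrow> u \<in> verts_of \<rho>'" if "{\<rho>, \<rho>'} = {\<sigma>, \<sigma>'}" "fst u \<in> B" for u \<rho> \<rho>'
  proof (cases "\<sigma> (fst u) = \<sigma>' (fst u)")
    case True
    then show ?thesis using that by (auto simp: g_def verts_of_def doubleton_eq_iff)
  next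
    case False
    have "sym_diff (snd u) {e (fst u)} \<subseteq> N (fst u) \<longleftrightarrow> snd u \<subseteq> N (fst u)"
      using e[OF that(2)] by auto
    moreover have "snd u \<subseteq> N (fst u) \<Longrightarrow>
        odd (card (sym_diff (snd u) {e (fst u)})) \<longleftrightarrow> even (card (snd u))"
      using even_card_sym_diff[of "snd u" "{e (fst u)}"] finite_N finite_subset by fastforce
    ultimately show ?thesis
      using that False by (cases u) (auto simp: g_def verts_of_def doubleton_eq_iff)
  qed
  have fB: "fst u \<in> B" if "u \<in> verts_of \<rho>" for u \<rho> using that by (auto simp: verts_of_def)
  have "bij_betw g (verts_of \<sigma>) (verts_of \<sigma>')"
  proof (rule bij_betw_byWitness[where f' = g])
    show "g ` verts_of \<sigma> \<subseteq> verts_of \<sigma>'" using mem[of \<sigma>' \<sigma>] fB by blast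
    show "g ` verts_of \<sigma>' \<subseteq> verts_of \<sigma>" using mem[of \<sigma> \<sigma>'] fB by blast
  qed (use gg in auto)
  then show ?thesis by (rule bij_betw_same_card)
qed

lemma pair_graph_graph_of: "inj_on h (verts_of \<sigma>) \<Longrightarrow> pair_graph (relabel_graph h (graph_of \<sigma>))"
proof
  let ?R = "relabel_graph h (graph_of \<sigma>)"
  assume inj: "inj_on h (verts_of \<sigma>)"
  show "finite (pverts ?R)" using finite_verts_of by (simp add: relabel_graph_def)
  have "finite (parcs (graph_of \<sigma>))"
    using finite_subset[OF parcs_graph_of_subset] finite_verts_of by (metis finite_SigmaI pverts_graph_of)
  then show "finite (parcs ?R)" by (simp add: relabel_graph_def)
  show "fst e \<in> pverts ?R" "snd e \<in> pverts ?R" if "e \<in> parcs ?R" for e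
    using that by (auto simp: relabel_graph_def parcs_graph_of_iff)
  show "fst e \<noteq> snd e" if "e \<in> parcs ?R" for e
    using that inj by (auto simp: relabel_graph_def parcs_graph_of_iff dest: inj_onD)
  have "sym (parcs ?R)"
    by (intro symI) (force simp: relabel_graph_def parcs_graph_of_iff)
  then show "symmetric (with_proj ?R)"
    by (simp add: symmetric_def arcs_ends_def arc_to_ends_def)
qed

lemma ex_nat_copy:
  "\<exists>(G' :: nat pair_pre_digraph) colG (H' :: nat pair_pre_digraph) colH.
    pair_graph G' \<and> pair_graph H' \<and> card (pverts G') = card (verts_of (\<lambda>_. False)) \<and>
    card (pverts H') = card (verts_of \<tau>) \<and>
    (\<forall>d t. wl_distinguishes_in d t G' colG H' colH \<longleftrightarrow> wl_distinguishes_in d t G vcol H vcol)"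
proof -
  obtain h :: "'b \<times> 'v set \<Rightarrow> nat" where h: "inj_on h (verts_of (\<lambda>_. False) \<union> verts_of \<tau>)"
    using finite_imp_inj_to_nat_seg[of "verts_of (\<lambda>_. False) \<union> verts_of \<tau>"] finite_verts_of by auto
  then have inj: "inj_on h (verts_of (\<lambda>_. False))" "inj_on h (verts_of \<tau>)"
    by (auto intro: inj_on_subset)
  define col where "col V x = vcol (inv_into V h x)" for V x
  have "wl_distinguishes_in d t (relabel_graph h G) (col (verts_of (\<lambda>_. False)))
      (relabel_graph h H) (col (verts_of \<tau>)) \<longleftrightarrow> wl_distinguishes_in d t G vcol H vcol" for d t
    using inj by (intro wl_distinguishes_in_relabel parcs_graph_of_subset) (auto simp: col_def)
  moreover have "card (pverts (relabel_graph h G)) = card (verts_of (\<lambda>_. False))"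
      "card (pverts (relabel_graph h H)) = card (verts_of \<tau>)"
    using inj by (auto simp: relabel_graph_def card_image)
  ultimately show ?thesis using pair_graph_graph_of inj by blast
qed

end

section \<open>Closeness of residues\<close>

definition close :: "int \<Rightarrow> int \<Rightarrow> int \<Rightarrow> int \<Rightarrow> bool" where
  "close q d x y \<longleftrightarrow> (\<exists>\<delta>. \<bar>\<delta>\<bar> \<le> d \<and> [x = y + \<delta>] (mod q))"

lemma close_refl: "0 \<le> d \<Longrightarrow> close q d x x"
  unfolding close_def by (intro exI[of _ 0]) auto

lemma close_sym: "close q d x y \<Longrightarrow> close q d y x"
proof -
  assume "close q d x y"
  then obtain \<delta> where "\<bar>\<delta>\<bar> \<le> d" "[x = y + \<delta>] (mod q)" by (auto simp: close_def)
  moreover from this(2) have "[y = x + - \<delta>] (mod q)"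
    by (simp add: cong_iff_dvd_diff) (metis add_diff_eq diff_add_eq_diff_diff_swap dvd_minus_iff minus_diff_eq)
  ultimately show ?thesis unfolding close_def by (intro exI[of _ "- \<delta>"]) auto
qed

lemma close_trans: "close q d x y \<Longrightarrow> close q e y z \<Longrightarrow> close q (d + e) x z"
proof -
  assume "close q d x y" "close q e y z"
  then obtain \<delta> \<epsilon> where "\<bar>\<delta>\<bar> \<le> d" "[x = y + \<delta>] (mod q)" "\<bar>\<epsilon>\<bar> \<le> e" "[y = z + \<epsilon>] (mod q)"
    by (auto simp: close_def)
  moreover from this(2,4) have "[x = z + (\<delta> + \<epsilon>)] (mod q)"
    by (metis add.assoc add.commute cong_add_rcancel cong_trans)
  ultimately show ?thesis unfolding close_def by (intro exI[of _ "\<delta> + \<epsilon>"]) auto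
qed

lemma close_mono: "close q d x y \<Longrightarrow> d \<le> e \<Longrightarrow> close q e x y"
  unfolding close_def by force

section \<open>Arcs on a circle whose ends avoid the pebbles\<close>

lemma avoid_residues:
  assumes T: "finite T" "int (card T) < D" and D: "D \<le> q"
  shows "\<exists>u. 1 \<le> u \<and> u \<le> D \<and> (\<forall>t\<in>T. \<not> [pos t = b + u] (mod q))"
proof (rule ccontr)
  assume "\<not> ?thesis"
  then have "\<forall>u\<in>{1..D}. \<exists>t\<in>T. [pos t = b + u] (mod q)" by auto
  then obtain f where f: "\<And>u. u \<in> {1..D} \<Longrightarrow> f u \<in> T \<and> [pos (f u) = b + u] (mod q)"
    by metis
  have "inj_on f {1..D}"
  proof (rule inj_onI)
    fix u v assume uv: "u \<in> {1..D}" "v \<in> {1..D}" "f u = f v"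
    then have "[b + u = b + v] (mod q)" using f by (metis cong_sym cong_trans)
    then have "[u = v] (mod q)" by (simp add: cong_add_lcancel)
    then have "q dvd u - v" by (simp add: cong_iff_dvd_diff)
    moreover have "\<bar>u - v\<bar> < q" using uv D by auto
    ultimately show "u = v" using dvd_imp_le_int[of "u - v" q] by auto
  qed
  moreover have "f ` {1..D} \<subseteq> T" using f by auto
  ultimately have "card {1..D} \<le> card T" using T card_inj_on_le by blast
  then show False using T by simp
qed

text \<open>Fewer than \<open>D\<close> positions cannot block all of \<open>D\<close> distinct
  residues, so within distance \<open>D\<close> of \<open>b\<close> there is a free end on either
  side; the lower one is found by reflection. The arc between them stays too close to
  \<open>b\<close> to reach \<open>a\<close>.\<close>

lemma circular_interval:
  fixes q D a b :: int and pos :: "'a \<Rightarrow> int"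
  assumes q: "0 < q" and T: "finite T" "int (card T) < D" and far: "\<not> close q D a b"
  shows "\<exists>\<chi>. (\<forall>x y. [x = y] (mod q) \<longrightarrow> \<chi> x = \<chi> y) \<and> \<not> \<chi> a \<and> \<not> \<chi> (a + 1) \<and> \<chi> b \<and> \<chi> (b + 1) \<and>
    (\<forall>t\<in>T. \<chi> (pos t) \<longleftrightarrow> \<chi> (pos t + 1))"
proof -
  have D: "D < q"
  proof (rule ccontr)
    assume "\<not> D < q"
    then have "\<bar>(a - b) mod q\<bar> \<le> D" using pos_mod_bound[OF q, of "a - b"] pos_mod_sign[OF q, of "a - b"] by linarith
    moreover have "[a = b + (a - b) mod q] (mod q)" by (simp add: cong_def mod_simps)
    ultimately show False using far by (auto simp: close_def)
  qed
  obtain u where u: "1 \<le> u" "u \<le> D" "\<And>t. t \<in> T \<Longrightarrow> \<not> [pos t = b + u] (mod q)"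
    using avoid_residues[OF T] D by (metis less_imp_le)
  obtain w where w: "1 \<le> w" "w \<le> D" "\<And>t. t \<in> T \<Longrightarrow> \<not> [- pos t = - b + w] (mod q)"
    using avoid_residues[OF T, of q "\<lambda>t. - pos t" "- b"] D by (metis less_imp_le)
  have w': "\<not> [pos t = b - w] (mod q)" if "t \<in> T" for t
    using w(3)[OF that] cong_minus_minus_iff[of "pos t" "b - w" q] by simp
  \<comment> \<open>The arc from \<open>b - w + 1\<close> to \<open>b + u\<close>, repeated modulo
    \<open>q\<close>; its value can change only between \<open>b - w\<close> or \<open>b + u\<close>
    and the successor.\<close>
  define \<chi> where "\<chi> x \<longleftrightarrow> (x - b + w - 1) mod q < w + u" for x
  have per: "\<chi> x = \<chi> y" if "[x = y] (mod q)" for x y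
  proof -
    have "[x - b + w - 1 = y - b + w - 1] (mod q)"
      using that by (intro cong_add cong_diff) auto
    then show ?thesis by (simp add: \<chi>_def cong_def)
  qed
  have near: "close q D x b" if x: "\<chi> x \<or> \<chi> (x + 1)" for x
  proof -
    have *: "close q D x b" if "\<chi> (x + e)" "e = 0 \<or> e = 1" for e
    proof -
      let ?z = "(x + e - b + w - 1) mod q"
      have z: "0 \<le> ?z" "?z < w + u" using that q by (auto simp: \<chi>_def)
      have "[x + e - b + w - 1 = ?z] (mod q)" by (simp add: cong_def)
      then have "[x + e - b + w - 1 + (b - w + 1 - e) = ?z + (b - w + 1 - e)] (mod q)"
        by (simp only: cong_add_rcancel)
      moreover have "x + e - b + w - 1 + (b - w + 1 - e) = x" "?z + (b - w + 1 - e) = b + (?z - w + 1 - e)"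
        by simp_all
      ultimately have "[x = b + (?z - w + 1 - e)] (mod q)" by simp
      then show ?thesis
        using z u w that unfolding close_def by (intro exI[of _ "?z - w + 1 - e"]) auto
    qed
    show ?thesis using *[of 0] *[of 1] x by auto
  qed
  have step: "[x = b + u] (mod q) \<or> [x = b - w] (mod q)" if x: "\<chi> x \<noteq> \<chi> (x + 1)" for x
  proof -
    let ?y = "x - b + w - 1"
    have e: "\<chi> (x + 1) \<longleftrightarrow> (?y mod q + 1) mod q < w + u"
      by (simp add: \<chi>_def mod_simps algebra_simps)
    have bd: "0 \<le> ?y mod q" "?y mod q < q" using q by auto
    have y: "[?y = ?y mod q] (mod q)" by (simp add: cong_def)
    show ?thesis
    proof (cases "?y mod q = q - 1")
      case True
      then have "[?y = - 1] (mod q)" by (metis cong_def mod_mod_trivial minus_mod_self1)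
      then have "[?y + (b - w + 1) = - 1 + (b - w + 1)] (mod q)" by (simp only: cong_add_rcancel)
      then show ?thesis by (simp add: algebra_simps)
    next
      case False
      then have "(?y mod q + 1) mod q = ?y mod q + 1" using bd by (intro mod_pos_pos_trivial) auto
      then have "?y mod q = w + u - 1" using x e by (auto simp: \<chi>_def)
      then have "[?y = w + u - 1] (mod q)" using y by simp
      then have "[?y + (b - w + 1) = w + u - 1 + (b - w + 1)] (mod q)" by (simp only: cong_add_rcancel)
      then show ?thesis by (simp add: algebra_simps)
    qed
  qed
  have "(w - 1) mod q = w - 1" "w mod q = w" using w D by (auto intro!: mod_pos_pos_trivial)
  then have "\<chi> b" "\<chi> (b + 1)" using u w by (auto simp: \<chi>_def algebra_simps)
  moreover have "\<chi> (pos t) \<longleftrightarrow> \<chi> (pos t + 1)" if "t \<in> T" for t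
    using step[of "pos t"] u(3)[OF that] w'[OF that] by blast
  ultimately show ?thesis
    using per near[of a] far by (intro exI[of _ \<chi>]) blast
qed

lemma chinese_remainder_int_set:
  fixes m u :: "'a \<Rightarrow> int"
  assumes "finite A" "\<And>i j. i \<in> A \<Longrightarrow> j \<in> A \<Longrightarrow> i \<noteq> j \<Longrightarrow> coprime (m i) (m j)"
  shows "\<exists>x. \<forall>i\<in>A. [x = u i] (mod m i)"
  using assms
proof (induction A)
  case (insert a A)
  then obtain x where x: "\<forall>i\<in>A. [x = u i] (mod m i)" by auto
  have "coprime (m a) (\<Prod>i\<in>A. m i)"
    using insert by (intro prod_coprime_right) auto
  then obtain y where y: "[y = u a] (mod m a)" "[y = x] (mod (\<Prod>i\<in>A. m i))"
    using binary_chinese_remainder_int by blast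
  have "[y = u i] (mod m i)" if "i \<in> A" for i
  proof -
    have "m i dvd (\<Prod>i\<in>A. m i)" using insert.hyps that by (intro dvd_prodI) auto
    then have "[y = x] (mod m i)" using y(2) cong_dvd_modulus by blast
    then show ?thesis using x that cong_trans by blast
  qed
  then show ?case using y by auto
qed simp

lemma odd_card_Int_4:
  assumes "distinct [w, x, y, z]"
  shows "odd (card (f \<inter> {w, x, y, z})) \<longleftrightarrow> ((w \<in> f) \<noteq> ((x \<in> f) \<noteq> ((y \<in> f) \<noteq> (z \<in> f))))"
  using assms by (cases "w \<in> f"; cases "x \<in> f"; cases "y \<in> f"; cases "z \<in> f") (simp_all add: Int_insert_right)

section \<open>The compressed cylinder\<close>

text \<open>\<open>Hor i a\<close> is the edge of row \<open>i\<close> that enters column \<open>a\<close> from the left, \<open>Ver i x\<close> the edge between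
  row \<open>i\<close> and the cyclically next row, \<open>Edge s {i, j}\<close> an edge of the gadget \<open>s\<close>; the variables \<open>Dum\<close>
  and the equations \<open>Pad\<close> only add single vertices to reach the prescribed graph size. The common
  factor \<open>W\<close> of all moduli exceeds every drift between the pebbles of a cut, so that small shifts
  modulo different \<open>p l\<close> must coincide.\<close>

datatype cvar = Hor nat int | Ver nat int | Edge bool "nat set" | Dum nat

datatype cblock = Cell nat int | Gad bool nat | Pad nat

locale compressed_cylinder =
  fixes k c npad :: nat and p :: "nat \<Rightarrow> int" and W :: int
  assumes c_pos: "1 \<le> c" and c_less: "c < k" and p_gt: "\<And>l. l < k \<Longrightarrow> 1 < p l"
    and p_coprime: "\<And>l l'. l < k \<Longrightarrow> l' < k \<Longrightarrow> l \<noteq> l' \<Longrightarrow> coprime (p l) (p l')"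
    and W_coprime: "\<And>l. l < k \<Longrightarrow> coprime W (p l)" and W_gt: "8 * int k < W"
begin

text \<open>For rows below \<open>k\<close> this is \<open>(l - r) mod k\<close>, the number of
  \<open>nxt\<close> steps from row \<open>r\<close> to row \<open>l\<close>. Factor
  \<open>l\<close> thus divides the moduli of row \<open>l\<close> and of the \<open>c\<close> rows
  before it.\<close>

definition rk :: "nat \<Rightarrow> nat \<Rightarrow> nat" where
  "rk l r = (if r \<le> l then l - r else l + k - r)"

definition m :: "nat \<Rightarrow> int" where
  "m i = W * (\<Prod>l\<in>{l. l < k \<and> rk l i \<le> c}. p l)"

definition L :: int where "L = W * (\<Prod>l<k. p l)"

definition nxt :: "nat \<Rightarrow> nat" where "nxt i = (if Suc i = k then 0 else Suc i)"
definition prv :: "nat \<Rightarrow> nat" where "prv i = (if i = 0 then k - 1 else i - 1)"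

text \<open>A vertical variable is shared by cells of two rows, wrapped modulo \<open>m i\<close>
  and modulo \<open>m (nxt i)\<close>; the gcd is the finest identification compatible with
  both.\<close>

definition g :: "nat \<Rightarrow> int" where "g i = gcd (m i) (m (nxt i))"

definition J :: "bool \<Rightarrow> int" where "J s = (if s then L div 2 else 0)"

text \<open>The horizontal variable at the column of a gadget lies in two cells as well as in the
  gadget. A set of variables that is even at all cells may therefore still flip gadget
  equations.\<close>

fun nb :: "cblock \<Rightarrow> cvar set" where
  "nb (Cell i a) = {Hor i (a mod m i), Hor i ((a + 1) mod m i), Ver i (a mod g i), Ver (prv i) (a mod g (prv i))}"
| "nb (Gad s i) = insert (Hor i (J s mod m i)) {Edge s {i, j} |j. j < k \<and> j \<noteq> i}"
| "nb (Pad j) = {Dum j}"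

definition core :: "cblock set" where
  "core = (\<lambda>(i, a). Cell i a) ` (SIGMA i:{..<k}. {0..<m i}) \<union> (\<lambda>(s, i). Gad s i) ` (UNIV \<times> {..<k})"

definition blocks :: "cblock set" where "blocks = core \<union> Pad ` {..<npad}"

definition charge :: "cblock \<Rightarrow> bool" where "charge b \<longleftrightarrow> b = Gad False 0"

definition bcol :: "cblock \<Rightarrow> nat" where "bcol = (SOME f. inj_on f blocks)"

lemma finite_blocks: "finite blocks"
  by (auto simp: blocks_def core_def)

lemma finite_nb: "finite (nb b)"
  by (cases b) auto

sublocale parity_system blocks nb charge bcol
proof
  show "inj_on bcol blocks"
    unfolding bcol_def using finite_imp_inj_to_nat_seg[OF finite_blocks] by (metis (mono_tags) someI_ex)
qed (use finite_blocks finite_nb in auto)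

lemma k_ge2: "2 \<le> k" using c_pos c_less by simp

lemma Cell_blocks: "Cell i a \<in> blocks \<longleftrightarrow> i < k \<and> 0 \<le> a \<and> a < m i"
  by (auto simp: blocks_def core_def)

lemma Gad_blocks: "Gad s i \<in> blocks \<longleftrightarrow> i < k"
  by (auto simp: blocks_def core_def)

lemma W_pos: "0 < W" using W_gt by linarith

lemma m_gt1: "1 < m i"
proof -
  have "1 \<le> (\<Prod>l\<in>{l. l < k \<and> rk l i \<le> c}. p l)"
    by (intro prod_ge_1) (use p_gt in force)
  then have "W * 1 \<le> m i" unfolding m_def using W_pos by (intro mult_left_mono) auto
  then show ?thesis using W_gt k_ge2 by linarith
qed

section \<open>Cyclic arithmetic of rows and factors\<close>

lemma prv_less: "i < k \<Longrightarrow> prv i < k" and nxt_less: "i < k \<Longrightarrow> nxt i < k"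
  using k_ge2 by (auto simp: prv_def nxt_def)

lemma prv_neq: "i < k \<Longrightarrow> prv i \<noteq> i"
  using k_ge2 by (auto simp: prv_def)

lemma nxt_prv: "i < k \<Longrightarrow> nxt (prv i) = i"
  using k_ge2 by (auto simp: prv_def nxt_def)

lemma rk_less: "l < k \<Longrightarrow> r < k \<Longrightarrow> rk l r < k"
  by (auto simp: rk_def)

lemma rk_rk: "l < k \<Longrightarrow> r < k \<Longrightarrow> rk l (rk l r) = r"
  by (auto simp: rk_def)

lemma rk_inj: "l < k \<Longrightarrow> r < k \<Longrightarrow> r' < k \<Longrightarrow> rk l r = rk l r' \<Longrightarrow> r = r'"
  by (metis rk_rk)

lemma rk_nxt: "l < k \<Longrightarrow> r < k \<Longrightarrow> 0 < rk l r \<Longrightarrow> rk l (nxt r) = rk l r - 1"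
  by (auto simp: rk_def nxt_def)

lemma rk_prv: "l < k \<Longrightarrow> r < k \<Longrightarrow> rk l (prv r) = (if rk l r = k - 1 then 0 else rk l r + 1)"
  by (auto simp: rk_def prv_def)

lemma card_arc: "l < k \<Longrightarrow> card {r. r < k \<and> rk l r \<le> c} = c + 1"
proof -
  assume l: "l < k"
  have "bij_betw (rk l) {r. r < k \<and> rk l r \<le> c} {..c}"
    by (rule bij_betw_byWitness[where f' = "rk l"]) (use l rk_rk rk_less c_less in auto)
  then show ?thesis by (simp add: bij_betw_same_card)
qed

lemma card_factors: "i < k \<Longrightarrow> card {l. l < k \<and> rk l i \<le> c} \<le> c + 1"
proof -
  assume i: "i < k"
  have "inj_on (\<lambda>l. rk l i) {l. l < k \<and> rk l i \<le> c}"
    using i by (auto simp: inj_on_def rk_def split: if_splits)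
  moreover have "(\<lambda>l. rk l i) ` {l. l < k \<and> rk l i \<le> c} \<subseteq> {..c}" by auto
  ultimately have "card {l. l < k \<and> rk l i \<le> c} \<le> card {..c}"
    by (rule card_inj_on_le[OF _ _ finite_atMost])
  then show ?thesis by simp
qed

lemma W_dvd_m: "W dvd m i" by (simp add: m_def)

lemma Wp_dvd_m: "l < k \<Longrightarrow> rk l i \<le> c \<Longrightarrow> W * p l dvd m i"
  unfolding m_def by (intro mult_dvd_mono dvd_prodI) auto

lemma p_dvd_m: "l < k \<Longrightarrow> rk l i \<le> c \<Longrightarrow> p l dvd m i"
  using Wp_dvd_m dvd_mult_right by blast

lemma cong_WprodI:
  assumes "A \<subseteq> {..<k}" "[x = y] (mod W)" "\<And>l. l \<in> A \<Longrightarrow> [x = y] (mod p l)"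
  shows "[x = y] (mod (W * (\<Prod>l\<in>A. p l)))"
proof (rule coprime_cong_mult)
  show "[x = y] (mod (\<Prod>l\<in>A. p l))"
    using assms(3) subsetD[OF assms(1)] p_coprime by (intro cong_cong_prod_coprime) auto
  show "coprime W (\<Prod>l\<in>A. p l)"
    using assms(1) W_coprime by (intro prod_coprime_right) auto
qed (rule assms(2))

subsection \<open>Parities at the blocks\<close>

lemma cell_parity:
  assumes "i < k"
  shows "odd (card (f \<inter> nb (Cell i a))) \<longleftrightarrow> ((Hor i (a mod m i) \<in> f) \<noteq> ((Hor i ((a + 1) mod m i) \<in> f) \<noteq>
    ((Ver i (a mod g i) \<in> f) \<noteq> (Ver (prv i) (a mod g (prv i)) \<in> f))))"
proof -
  have "a mod m i \<noteq> (a + 1) mod m i"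
  proof
    assume "a mod m i = (a + 1) mod m i"
    then have "m i dvd (a + 1) - a" by (metis mod_eq_dvd_iff)
    then show False using m_gt1[of i] by simp
  qed
  then show ?thesis
    using prv_neq[OF assms] unfolding nb.simps by (intro odd_card_Int_4) auto
qed

lemma gad_parity:
  "odd (card (f \<inter> nb (Gad s i))) \<longleftrightarrow>
     ((Hor i (J s mod m i) \<in> f) \<noteq> odd (card {j. j < k \<and> j \<noteq> i \<and> Edge s {i, j} \<in> f}))"
proof -
  let ?E = "{j. j < k \<and> j \<noteq> i \<and> Edge s {i, j} \<in> f}"
  have "f \<inter> nb (Gad s i) = (f \<inter> {Hor i (J s mod m i)}) \<union> (\<lambda>j. Edge s {i, j}) ` ?E"
    by auto
  moreover have "card ((f \<inter> {Hor i (J s mod m i)}) \<union> (\<lambda>j. Edge s {i, j}) ` ?E) =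
      card (f \<inter> {Hor i (J s mod m i)}) + card ((\<lambda>j. Edge s {i, j}) ` ?E)"
    by (intro card_Un_disjoint) auto
  moreover have "card ((\<lambda>j. Edge s {i, j}) ` ?E) = card ?E"
    by (intro card_image inj_onI) (auto simp: doubleton_eq_iff)
  ultimately show ?thesis by (auto simp: Int_insert_right)
qed

lemma sat_sym_diff:
  "sat (sym_diff f F) b \<longleftrightarrow> (sat f b \<longleftrightarrow> even (card (F \<inter> nb b)))"
proof -
  have "sym_diff f F \<inter> nb b = sym_diff (f \<inter> nb b) (F \<inter> nb b)" by auto
  then show ?thesis
    using even_card_sym_diff[of "f \<inter> nb b" "F \<inter> nb b"] finite_nb[of b] by (auto simp: sat_def)
qed

lemma agree_sym_diff: "F \<inter> nb b = {} \<Longrightarrow> sym_diff f F \<inter> nb b = f \<inter> nb b"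
  by auto

text \<open>Within a gadget, whose edges form a complete graph, violated equations at unpebbled blocks can be
  cancelled in pairs or moved to any unpebbled block.\<close>

lemma merge_defects:
  assumes i': "i' < k" "Gad s i' \<notin> S" and X: "X = {i. i < k \<and> \<not> sat f (Gad s i)}"
    and free: "\<And>i. i \<in> X \<Longrightarrow> Gad s i \<notin> S" and S: "S \<subseteq> blocks"
  shows "\<exists>f'. (\<forall>b\<in>S. f' \<inter> nb b = f \<inter> nb b) \<and> (\<forall>b. (\<forall>i. b \<noteq> Gad s i) \<longrightarrow> sat f' b = sat f b) \<and>
    (\<forall>i<k. sat f' (Gad s i) \<longleftrightarrow> \<not> (i = i' \<and> odd (card X)))"
proof -
  have finX: "finite X" using X by simp
  \<comment> \<open>Flipping the edges from all other defects to \<open>i'\<close> repairs each of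
    them and collects their parity at \<open>i'\<close>.\<close>
  define F where "F = (\<lambda>i. Edge s {i, i'}) ` (X - {i'})"
  have other: "F \<inter> nb b = {}" if "\<forall>i. b \<noteq> Gad s i" for b
    using that by (cases b) (auto simp: F_def)
  have Fj: "F \<inter> nb (Gad s j) = (if j \<in> X then {Edge s {j, i'}} else {})" if "j \<noteq> i'" for j
  proof -
    have "Edge s {j, i'} \<in> nb (Gad s j)" using i' that by auto
    moreover have "i = j" if "i \<in> X - {i'}" "Edge s {i, i'} \<in> nb (Gad s j)" for i
      using that \<open>j \<noteq> i'\<close> by (auto simp: doubleton_eq_iff)
    ultimately show ?thesis using that unfolding F_def by auto
  qed
  have Fi': "F \<inter> nb (Gad s i') = F"
    using X by (auto simp: F_def insert_commute)
  have cardF: "card F = card (X - {i'})"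
    unfolding F_def by (intro card_image inj_onI) (auto simp: doubleton_eq_iff)
  have "F \<inter> nb b = {}" if "b \<in> S" for b
  proof (cases "\<exists>j. b = Gad s j")
    case True
    then obtain j where "b = Gad s j" by blast
    moreover from this have "j \<noteq> i'" "j \<notin> X" using that free i' by auto
    ultimately show ?thesis using Fj[of j] by simp
  qed (use other in blast)
  moreover have "sat (sym_diff f F) (Gad s i) \<longleftrightarrow> \<not> (i = i' \<and> odd (card X))" if i: "i < k" for i
  proof (cases "i = i'")
    case True
    show ?thesis
    proof (cases "i' \<in> X")
      case t: True
      then have "card X = Suc (card (X - {i'}))" using finX by (metis card_Suc_Diff1)
      moreover have "\<not> sat f (Gad s i')" using t X by simp
      ultimately show ?thesis using True by (simp add: sat_sym_diff Fi' cardF del: nb.simps)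
    next
      case False
      then have "X - {i'} = X" by auto
      moreover have "sat f (Gad s i')" using False X i' by simp
      ultimately show ?thesis using True by (simp add: sat_sym_diff Fi' cardF del: nb.simps)
    qed
  next
    case False
    then show ?thesis using Fj[OF False] X i by (auto simp: sat_sym_diff simp del: nb.simps)
  qed
  ultimately show ?thesis
    using other by (intro exI[of _ "sym_diff f F"]) (auto simp: sat_sym_diff simp del: nb.simps intro!: agree_sym_diff)
qed

subsection \<open>Unit flows\<close>

text \<open>Adding a unit flow to an assignment flips the parity of the horizontal variables in every
  column, hence carries the violated equation from one gadget to the other one.\<close>

definition unit_flow :: "cblock set \<Rightarrow> cvar set \<Rightarrow> bool" where
  "unit_flow S F \<longleftrightarrow> (\<forall>i<k. \<forall>a. even (card (F \<inter> nb (Cell i a)))) \<and> (\<forall>s A. Edge s A \<notin> F) \<and>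
     (\<forall>j. Dum j \<notin> F) \<and> (\<forall>x. odd (card {i. i < k \<and> Hor i (x mod m i) \<in> F})) \<and>
     (\<forall>b\<in>S. F \<inter> nb b = {})"

fun row :: "cblock \<Rightarrow> nat" where
  "row (Cell i a) = i"
| "row (Gad s i) = i"
| "row (Pad j) = k"

fun pos :: "cblock \<Rightarrow> int" where
  "pos (Cell i a) = a"
| "pos (Gad s i) = J s"
| "pos (Pad j) = 0"

definition pebbles :: "cblock set \<Rightarrow> nat \<Rightarrow> cblock set" where
  "pebbles S i = {b \<in> S. row b = i}"

lemma flow_avoids:
  assumes "b \<in> blocks" "\<And>s A. Edge s A \<notin> F" "\<And>j. Dum j \<notin> F"
    and "row b < k \<Longrightarrow> Hor (row b) (pos b mod m (row b)) \<notin> F \<and> Hor (row b) ((pos b + 1) mod m (row b)) \<notin> F \<and>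
      Ver (row b) (pos b mod g (row b)) \<notin> F \<and> Ver (prv (row b)) (pos b mod g (prv (row b))) \<notin> F"
  shows "F \<inter> nb b = {}"
  using assms by (cases b) (auto simp: Cell_blocks Gad_blocks)

text \<open>A full turn around an unpebbled row meets each of its cells in exactly two
  variables.\<close>

lemma row_flow:
  assumes i: "i < k" and S: "S \<subseteq> blocks" and free: "pebbles S i = {}"
  shows "unit_flow S {Hor i (x mod m i) |x. True}" (is "unit_flow S ?F")
  unfolding unit_flow_def
proof (intro conjI allI impI ballI)
  fix r a assume r: "r < k"
  show "even (card (?F \<inter> nb (Cell r a)))"
    using cell_parity[OF r, of ?F a] by (cases "r = i") auto
next
  fix x
  have "{r. r < k \<and> Hor r (x mod m r) \<in> ?F} = {i}" using i by auto
  then show "odd (card {r. r < k \<and> Hor r (x mod m r) \<in> ?F})" by simp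
next
  fix b assume b: "b \<in> S"
  then have "row b \<noteq> i" using free by (auto simp: pebbles_def)
  then show "?F \<inter> nb b = {}" using S b by (intro flow_avoids) auto
qed auto

text \<open>The flow runs along row \<open>i\<close> inside the periodic set \<open>\<chi>\<close> and along row \<open>i'\<close> outside of it,
  and crosses the rows in between vertically at the boundary of \<open>\<chi>\<close>.\<close>

lemma two_row_flow:
  assumes i: "i < k" "i' < k" "i \<noteq> i'"
    and R: "\<And>r. r < k \<Longrightarrow> (r \<in> R) \<noteq> (prv r \<in> R) \<longleftrightarrow> r = i \<or> r = i'"
    and q: "q dvd m i" "q dvd m i'" "\<And>r. r \<in> R \<Longrightarrow> q dvd g r"
    and per: "\<And>x y. [x = y] (mod q) \<Longrightarrow> \<chi> x = \<chi> y"
    and S: "S \<subseteq> blocks"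
    and Si: "\<And>b. b \<in> S \<Longrightarrow> row b = i \<Longrightarrow> \<not> \<chi> (pos b) \<and> \<not> \<chi> (pos b + 1)"
    and Si': "\<And>b. b \<in> S \<Longrightarrow> row b = i' \<Longrightarrow> \<chi> (pos b) \<and> \<chi> (pos b + 1)"
    and bd: "\<And>b. b \<in> S \<Longrightarrow> \<chi> (pos b) \<longleftrightarrow> \<chi> (pos b + 1)"
  shows "\<exists>F. unit_flow S F"
proof -
  define F where "F = {Hor i (x mod m i) |x. \<chi> x} \<union> {Hor i' (x mod m i') |x. \<not> \<chi> x} \<union>
    {Ver r (x mod g r) |r x. r \<in> R \<and> \<chi> x \<noteq> \<chi> (x + 1)}"
  \<comment> \<open>Membership in \<open>F\<close> must not depend on the representative
    \<open>x\<close>; it does not, since \<open>\<chi>\<close> has period \<open>q\<close> and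
    \<open>q\<close> divides every modulus involved.\<close>
  have mod_eq: "\<chi> x = \<chi> y" if "x mod n = y mod n" "q dvd n" for x y n
  proof (rule per)
    show "[x = y] (mod q)" using that cong_dvd_modulus[of x y n q] by (simp add: cong_def)
  qed
  have i1: "(\<exists>y. x mod m i = y mod m i \<and> \<chi> y) \<longleftrightarrow> \<chi> x" for x
    by (metis mod_eq q(1))
  have i2: "(\<exists>y. x mod m i' = y mod m i' \<and> \<not> \<chi> y) \<longleftrightarrow> \<not> \<chi> x" for x
    by (metis mod_eq q(2))
  have i3: "(\<exists>y. x mod g r = y mod g r \<and> \<chi> y \<noteq> \<chi> (y + 1)) \<longleftrightarrow> \<chi> x \<noteq> \<chi> (x + 1)" if r: "r \<in> R" for r x
  proof -
    have "\<chi> x = \<chi> y \<and> \<chi> (x + 1) = \<chi> (y + 1)" if "x mod g r = y mod g r" for y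
      using mod_eq[OF that q(3)[OF r]] mod_eq[OF mod_add_cong[OF that refl] q(3)[OF r]] by simp
    then show ?thesis by blast
  qed
  have Hor: "Hor r (x mod m r) \<in> F \<longleftrightarrow> (r = i \<and> \<chi> x) \<or> (r = i' \<and> \<not> \<chi> x)" for r x
  proof -
    have "Hor r (x mod m r) \<in> F \<longleftrightarrow> (r = i \<and> (\<exists>y. x mod m i = y mod m i \<and> \<chi> y)) \<or>
        (r = i' \<and> (\<exists>y. x mod m i' = y mod m i' \<and> \<not> \<chi> y))"
      unfolding F_def by blast
    then show ?thesis by (simp only: i1 i2)
  qed
  have Ver: "Ver r (x mod g r) \<in> F \<longleftrightarrow> r \<in> R \<and> \<chi> x \<noteq> \<chi> (x + 1)" for r x
  proof -
    have "Ver r (x mod g r) \<in> F \<longleftrightarrow> r \<in> R \<and> (\<exists>y. x mod g r = y mod g r \<and> \<chi> y \<noteq> \<chi> (y + 1))"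
      unfolding F_def by blast
    then show ?thesis using i3[of r x] by blast
  qed
  have "unit_flow S F"
    unfolding unit_flow_def
  proof (intro conjI allI impI ballI)
    fix r a assume r: "r < k"
    show "even (card (F \<inter> nb (Cell r a)))"
      using cell_parity[OF r, of F a] R[OF r] i(3) by (auto simp: Hor Ver)
  next
    fix x
    have "{r. r < k \<and> Hor r (x mod m r) \<in> F} = (if \<chi> x then {i} else {i'})"
      using i by (auto simp: Hor)
    then show "odd (card {r. r < k \<and> Hor r (x mod m r) \<in> F})" by simp
  next
    fix b assume b: "b \<in> S"
    show "F \<inter> nb b = {}"
      using S b Si[OF b] Si'[OF b] bd[OF b]
      by (intro flow_avoids) (auto simp only: Hor Ver, auto simp: F_def)
  qed (auto simp: F_def)
  then show ?thesis by blast
qed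

text \<open>If the two pebbles were far apart, an arc around \<open>pos b'\<close> would avoid
  \<open>b\<close> and have unpebbled ends. The flow through row \<open>i\<close> inside the arc and
  row \<open>i'\<close> outside of it would then miss all pebbles.\<close>

lemma pebbles_close_wlog:
  assumes noflow: "\<not> (\<exists>F. unit_flow S F)" and S: "S \<subseteq> blocks" "card S < 2 * k"
    and l: "l < k" and i: "i < k" "i' < k" "rk l i' < rk l i"
    and b: "pebbles S i = {b}" "pebbles S i' = {b'}"
    and q: "0 < q" "\<And>r. r < k \<Longrightarrow> rk l r \<le> rk l i \<Longrightarrow> q dvd m r"
  shows "close q (2 * int k) (pos b) (pos b')"
proof (rule ccontr)
  assume far: "\<not> ?thesis"
  have finS: "finite S" using S(1) finite_blocks finite_subset by blast
  have ne: "i \<noteq> i'" using i by auto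
  obtain \<chi> where per: "\<And>x y. [x = y] (mod q) \<Longrightarrow> \<chi> x = \<chi> y"
    and \<chi>: "\<not> \<chi> (pos b)" "\<not> \<chi> (pos b + 1)" "\<chi> (pos b')" "\<chi> (pos b' + 1)"
      "\<And>t. t \<in> S \<Longrightarrow> \<chi> (pos t) \<longleftrightarrow> \<chi> (pos t + 1)"
    using circular_interval[OF q(1) finS _ far, of pos] S(2) by auto
  \<comment> \<open>The vertical edges passed on the way from \<open>i\<close> to \<open>i'\<close>
    along \<open>nxt\<close>, on which \<open>rk l\<close> decreases; all rows met have moduli
    divisible by \<open>q\<close>.\<close>
  define R where "R = {r. r < k \<and> rk l i' < rk l r \<and> rk l r \<le> rk l i}"
  have "\<exists>F. unit_flow S F"
  proof (rule two_row_flow[of i i' R q \<chi> S])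
    fix r assume r: "r < k"
    have e: "r = i \<longleftrightarrow> rk l r = rk l i" "r = i' \<longleftrightarrow> rk l r = rk l i'"
      using rk_inj[OF l r i(1)] rk_inj[OF l r i(2)] by auto
    show "(r \<in> R) \<noteq> (prv r \<in> R) \<longleftrightarrow> r = i \<or> r = i'"
      unfolding e using r i(3) prv_less[OF r] rk_prv[OF l r] rk_less[OF l r] rk_less[OF l i(1)]
      by (cases "rk l r = k - 1") (auto simp: R_def)
  next
    fix r assume "r \<in> R"
    then have r: "r < k" "0 < rk l r" "rk l r \<le> rk l i" by (auto simp: R_def)
    then show "q dvd g r"
      using q(2)[of r] q(2)[of "nxt r"] nxt_less rk_nxt[OF l r(1,2)] by (simp add: g_def)
  next
    show "q dvd m i" "q dvd m i'" using q(2) i by auto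
  next
    fix t assume "t \<in> S" "row t = i"
    then have "t \<in> pebbles S i" by (simp add: pebbles_def)
    then show "\<not> \<chi> (pos t) \<and> \<not> \<chi> (pos t + 1)" using b \<chi> by simp
  next
    fix t assume "t \<in> S" "row t = i'"
    then have "t \<in> pebbles S i'" by (simp add: pebbles_def)
    then show "\<chi> (pos t) \<and> \<chi> (pos t + 1)" using b \<chi> by simp
  qed (erule per | erule \<chi>(5) | rule i ne S)+
  then show False using noflow by blast
qed

lemma pebbles_close:
  assumes noflow: "\<not> (\<exists>F. unit_flow S F)" and S: "S \<subseteq> blocks" "card S < 2 * k"
    and l: "l < k" and i: "i < k" "i' < k"
    and b: "pebbles S i = {b}" "pebbles S i' = {b'}"
    and q: "0 < q" "\<And>r. r < k \<Longrightarrow> rk l r \<le> max (rk l i) (rk l i') \<Longrightarrow> q dvd m r"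
  shows "close q (2 * int k) (pos b) (pos b')"
proof -
  consider "rk l i' < rk l i" | "rk l i < rk l i'" | "i = i'"
    using rk_inj[OF l i] by linarith
  then show ?thesis
  proof cases
    case 1
    show ?thesis
      by (rule pebbles_close_wlog[OF noflow S l i 1 b q(1)], rule q(2)) (use 1 in auto)
  next
    case 2
    show ?thesis
      by (rule close_sym, rule pebbles_close_wlog[OF noflow S l i(2,1) 2 b(2,1) q(1)], rule q(2))
        (use 2 in auto)
  next
    case 3
    then show ?thesis using b by (auto intro: close_refl)
  qed
qed

subsection \<open>The position of a cut\<close>

text \<open>The position of a cut in the unrolled cylinder. Only rows with exactly one pebble are
  constrained, which makes \<open>near\<close> monotone in the set of pebbles.\<close>

definition near :: "cblock set \<Rightarrow> int \<Rightarrow> bool" where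
  "near S j \<longleftrightarrow> (\<forall>i<k. pebbles S i \<noteq> {} \<and> (\<forall>b. pebbles S i = {b} \<longrightarrow> close (m i) (2 * int k) (pos b) j))"

definition singles :: "cblock set \<Rightarrow> nat set" where
  "singles S = {i. i < k \<and> (\<exists>b. pebbles S i = {b})}"

lemma near_mono:
  assumes "near S j" "S \<subseteq> T"
  shows "near T j"
  unfolding near_def
proof (intro allI impI conjI)
  fix i assume i: "i < k"
  have sub: "pebbles S i \<subseteq> pebbles T i" using assms(2) by (auto simp: pebbles_def)
  then show "pebbles T i \<noteq> {}" using assms(1) i by (auto simp: near_def)
  fix b assume "pebbles T i = {b}"
  moreover have "pebbles S i \<noteq> {}" using assms(1) i by (simp add: near_def)
  ultimately have "pebbles S i = {b}" using sub by (simp add: subset_singleton_iff)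
  then show "close (m i) (2 * int k) (pos b) j" using assms(1) i by (auto simp: near_def)
qed

lemma near_gadget:
  assumes "\<And>i. i < k \<Longrightarrow> Gad s i \<in> S"
  shows "near S (J s)"
  unfolding near_def
proof (intro allI impI conjI)
  fix i assume i: "i < k"
  then have mem: "Gad s i \<in> pebbles S i" using assms by (auto simp: pebbles_def)
  then show "pebbles S i \<noteq> {}" by auto
  fix b assume "pebbles S i = {b}"
  then have "b = Gad s i" using mem by auto
  then show "close (m i) (2 * int k) (pos b) (J s)" by (auto intro: close_refl)
qed

lemma card_non_singles:
  assumes S: "finite S" "card S \<le> k + c" and ne: "\<And>i. i < k \<Longrightarrow> pebbles S i \<noteq> {}"
  shows "card ({..<k} - singles S) \<le> c"
proof -
  have fin: "finite (pebbles S i)" for i using S by (simp add: pebbles_def)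
  have "(\<Sum>i<k. 1 + (if i \<in> singles S then 0 else 1)) \<le> (\<Sum>i<k. card (pebbles S i))"
  proof (rule sum_mono)
    fix i assume i: "i \<in> {..<k}"
    then have "card (pebbles S i) \<noteq> 0" using ne fin by auto
    moreover have "card (pebbles S i) \<noteq> 1" if "i \<notin> singles S"
      using that i by (auto simp: singles_def card_1_singleton_iff)
    ultimately show "1 + (if i \<in> singles S then 0 else 1) \<le> card (pebbles S i)" by auto
  qed
  also have "(\<Sum>i<k. card (pebbles S i)) = card (\<Union>i<k. pebbles S i)"
    by (rule card_UN_disjoint[symmetric]) (use fin in \<open>auto simp: pebbles_def\<close>)
  also have "\<dots> \<le> card S" by (intro card_mono S) (auto simp: pebbles_def)
  also have "\<dots> \<le> k + c" by (rule S)
  also have "(\<Sum>i<k. 1 + (if i \<in> singles S then 0 else 1)) = k + card ({..<k} - singles S)"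
    by (simp only: sum.distrib) (simp add: sum.If_cases Collect_neg_eq[symmetric] Diff_eq)
  finally show ?thesis by simp
qed

text \<open>Each row takes one pebble and each non-single row a second one, so at most
  \<open>c\<close> rows are non-single, while factor \<open>l\<close> is present in
  \<open>c + 1\<close> rows. No factor of \<open>L\<close> is lost.\<close>

lemma single_in_arc:
  assumes S: "finite S" "card S \<le> k + c" and ne: "\<And>i. i < k \<Longrightarrow> pebbles S i \<noteq> {}" and l: "l < k"
  shows "\<exists>i\<in>singles S. rk l i \<le> c"
proof (rule ccontr)
  assume "\<not> ?thesis"
  then have "{r. r < k \<and> rk l r \<le> c} \<subseteq> {..<k} - singles S" by auto
  then have "c + 1 \<le> card ({..<k} - singles S)" using card_arc[OF l] card_mono[of "{..<k} - singles S" "{r. r < k \<and> rk l r \<le> c}"] by simp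
  then show False using card_non_singles[OF S ne] by simp
qed

lemma cong_small_eq:
  fixes x y :: int
  assumes "[x = y] (mod W)" "\<bar>x - y\<bar> < W"
  shows "x = y"
  using assms dvd_imp_le_int[of "x - y" W] by (auto simp: cong_iff_dvd_diff)

text \<open>Single pebbles are pairwise close modulo \<open>W\<close> and modulo each
  \<open>W * p l\<close> that their rows share. Subtracting from each position its drift against one
  reference row turns closeness into exact congruence, and Chinese remaindering then yields
  \<open>j\<close>.\<close>

lemma no_flow_imp_near:
  assumes noflow: "\<not> (\<exists>F. unit_flow S F)" and S: "S \<subseteq> blocks" "card S \<le> k + c"
  shows "\<exists>j. near S j"
proof -
  have finS: "finite S" using S(1) finite_blocks finite_subset by blast
  have ne: "pebbles S i \<noteq> {}" if "i < k" for i
    using row_flow[OF that S(1)] noflow by blast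
  have S2: "card S < 2 * k" using S c_less by simp
  have arc: "\<exists>i\<in>singles S. rk l i \<le> c" if "l < k" for l
    by (rule single_in_arc[OF finS S(2) _ that]) (rule ne)
  have k0: "0 < k" using k_ge2 by simp
  obtain i0 where i0: "i0 \<in> singles S" using arc[OF k0] by blast
  define a where "a i = pos (the_elem (pebbles S i))" for i
  have single: "i < k" "pebbles S i = {the_elem (pebbles S i)}" if i: "i \<in> singles S" for i
  proof -
    obtain b where "i < k" "pebbles S i = {b}" using i by (auto simp: singles_def)
    then show "i < k" "pebbles S i = {the_elem (pebbles S i)}" by simp_all
  qed
  have "\<forall>i\<in>singles S. \<exists>\<delta>. \<bar>\<delta>\<bar> \<le> 2 * int k \<and> [a i = a i0 + \<delta>] (mod W)"
  proof
    fix i assume i: "i \<in> singles S"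
    show "\<exists>\<delta>. \<bar>\<delta>\<bar> \<le> 2 * int k \<and> [a i = a i0 + \<delta>] (mod W)"
      unfolding a_def close_def[symmetric]
      by (rule pebbles_close[OF noflow S(1) S2 k0 single(1)[OF i] single(1)[OF i0] single(2)[OF i]
            single(2)[OF i0] W_pos W_dvd_m])
  qed
  from bchoice[OF this] obtain \<delta> where \<delta>: "\<And>i. i \<in> singles S \<Longrightarrow> \<bar>\<delta> i\<bar> \<le> 2 * int k"
      "\<And>i. i \<in> singles S \<Longrightarrow> [a i = a i0 + \<delta> i] (mod W)"
    by blast
  define b where "b i = a i - \<delta> i" for i
  have bW: "[b i = a i0] (mod W)" if "i \<in> singles S" for i
    using \<delta>(2)[OF that] by (simp add: b_def cong_iff_dvd_diff algebra_simps)
  have bp: "[b i = b i'] (mod p l)"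
    if i: "i \<in> singles S" "i' \<in> singles S" and l: "l < k" "rk l i \<le> c" "rk l i' \<le> c" for i i' l
  proof -
    have "close (W * p l) (2 * int k) (a i) (a i')"
      unfolding a_def
    proof (rule pebbles_close[OF noflow S(1) S2 l(1) _ _ single(2)[OF i(1)] single(2)[OF i(2)]])
      show "0 < W * p l" using W_pos p_gt[OF l(1)] by simp
      show "W * p l dvd m r" if "r < k" "rk l r \<le> max (rk l i) (rk l i')" for r
        using that l by (intro Wp_dvd_m) auto
    qed (use single i in auto)
    then obtain \<epsilon> where \<epsilon>: "\<bar>\<epsilon>\<bar> \<le> 2 * int k" "[a i = a i' + \<epsilon>] (mod (W * p l))"
      by (auto simp: close_def)
    have "[a i = a i' + \<epsilon>] (mod W)" using \<epsilon>(2) cong_modulus_mult by blast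
    then have "[a i0 + \<delta> i = a i0 + \<delta> i' + \<epsilon>] (mod W)"
      using \<delta>(2)[OF i(1)] \<delta>(2)[OF i(2)] by (meson cong_add cong_refl cong_sym cong_trans)
    then have "[\<delta> i = \<delta> i' + \<epsilon>] (mod W)" by (simp add: add.assoc cong_add_lcancel)
    \<comment> \<open>Three terms of size at most \<open>2 * k\<close> cannot wrap around modulo
      \<open>W\<close>; so the drift seen modulo \<open>W * p l\<close> is the one already fixed
      modulo \<open>W\<close>.\<close>
    then have "\<delta> i = \<delta> i' + \<epsilon>"
      using \<delta>(1)[OF i(1)] \<delta>(1)[OF i(2)] \<epsilon>(1) W_gt by (intro cong_small_eq) auto
    moreover have "[a i = a i' + \<epsilon>] (mod p l)"
      using \<epsilon>(2) cong_modulus_mult[of "a i" "a i' + \<epsilon>" "p l" W] by (simp add: mult.commute)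
    ultimately show ?thesis by (simp add: b_def cong_iff_dvd_diff algebra_simps)
  qed
  obtain e where e: "\<And>l. l < k \<Longrightarrow> e l \<in> singles S \<and> rk l (e l) \<le> c" using arc by metis
  obtain y where y: "\<And>l. l < k \<Longrightarrow> [y = b (e l)] (mod p l)"
    using chinese_remainder_int_set[of "{..<k}" p "\<lambda>l. b (e l)"] p_coprime by auto
  have "coprime W (\<Prod>l<k. p l)" using W_coprime by (intro prod_coprime_right) auto
  then obtain j where j: "[j = a i0] (mod W)" "[j = y] (mod (\<Prod>l<k. p l))"
    using binary_chinese_remainder_int by blast
  have jb: "[j = b i] (mod m i)" if i: "i \<in> singles S" for i
    unfolding m_def
  proof (rule cong_WprodI)
    show "[j = b i] (mod W)" using j(1) bW[OF i] cong_sym cong_trans by blast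
    fix l assume "l \<in> {l. l < k \<and> rk l i \<le> c}"
    then have l: "l < k" "rk l i \<le> c" by auto
    have "p l dvd (\<Prod>l<k. p l)" using l by (intro dvd_prodI) auto
    then have "[j = y] (mod p l)" using j(2) cong_dvd_modulus by blast
    then show "[j = b i] (mod p l)"
      using y[OF l(1)] bp[OF _ i l(1) _ l(2)] e[OF l(1)] cong_trans by blast
  qed auto
  have "near S j"
    unfolding near_def
  proof (intro allI impI conjI)
    fix i b' assume i: "i < k" and b': "pebbles S i = {b'}"
    then have s: "i \<in> singles S" by (auto simp: singles_def)
    have "[a i = j + \<delta> i] (mod m i)"
      using cong_sym[OF jb[OF s]] by (simp add: b_def cong_iff_dvd_diff algebra_simps)
    then have "close (m i) (2 * int k) (a i) j" using \<delta>(1)[OF s] by (auto simp: close_def)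
    then show "close (m i) (2 * int k) (pos b') j" by (simp add: a_def b')
  qed (use ne in blast)
  then show ?thesis by blast
qed

text \<open>Both positions are close to the same single pebbles. The factor \<open>W\<close> forces
  one common shift in all these rows, and together they carry every factor of
  \<open>L\<close>.\<close>

lemma near_unique:
  assumes T: "T \<subseteq> blocks" "card T \<le> k + c" and j: "near T j" "near T j'"
  shows "close L (4 * int k) j j'"
proof -
  have finT: "finite T" using T(1) finite_blocks finite_subset by blast
  have ne: "pebbles T i \<noteq> {}" if "i < k" for i using j(1) that by (auto simp: near_def)
  have arc: "\<exists>i\<in>singles T. rk l i \<le> c" if "l < k" for l
    by (rule single_in_arc[OF finT T(2) _ that]) (rule ne)
  have "\<forall>i\<in>singles T. \<exists>\<delta>. \<bar>\<delta>\<bar> \<le> 4 * int k \<and> [j = j' + \<delta>] (mod m i)"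
  proof
    fix i assume "i \<in> singles T"
    then obtain b where "i < k" "pebbles T i = {b}" by (auto simp: singles_def)
    then have "close (m i) (2 * int k) (pos b) j" "close (m i) (2 * int k) (pos b) j'"
      using j by (auto simp: near_def)
    from close_trans[OF close_sym[OF this(1)] this(2)]
    show "\<exists>\<delta>. \<bar>\<delta>\<bar> \<le> 4 * int k \<and> [j = j' + \<delta>] (mod m i)" by (simp add: close_def)
  qed
  from bchoice[OF this] obtain \<delta> where \<delta>: "\<And>i. i \<in> singles T \<Longrightarrow> \<bar>\<delta> i\<bar> \<le> 4 * int k"
      "\<And>i. i \<in> singles T \<Longrightarrow> [j = j' + \<delta> i] (mod m i)"
    by blast
  have \<delta>W: "[j = j' + \<delta> i] (mod W)" if "i \<in> singles T" for i
    using \<delta>(2)[OF that] W_dvd_m cong_dvd_modulus by blast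
  have "0 < k" using k_ge2 by simp
  then obtain i0 where i0: "i0 \<in> singles T" using arc by blast
  have eq: "\<delta> i = \<delta> i0" if i: "i \<in> singles T" for i
  proof (rule cong_small_eq)
    have "[j' + \<delta> i = j' + \<delta> i0] (mod W)" using \<delta>W[OF i] \<delta>W[OF i0] cong_sym cong_trans by blast
    then show "[\<delta> i = \<delta> i0] (mod W)" by (simp add: cong_add_lcancel)
    \<comment> \<open>Two shifts of size up to \<open>4 * k\<close> are compared here, the reason
      for \<open>8 * k < W\<close>.\<close>
    show "\<bar>\<delta> i - \<delta> i0\<bar> < W" using \<delta>(1)[OF i] \<delta>(1)[OF i0] W_gt by auto
  qed
  have "[j = j' + \<delta> i0] (mod L)"
    unfolding L_def
  proof (rule cong_WprodI)
    fix l assume "l \<in> {..<k}"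
    then have l: "l < k" by simp
    obtain i where i: "i \<in> singles T" "rk l i \<le> c" using arc[OF l] by blast
    then show "[j = j' + \<delta> i0] (mod p l)"
      using \<delta>(2)[OF i(1)] eq[OF i(1)] p_dvd_m[OF l i(2)] cong_dvd_modulus by metis
  qed (use \<delta>W i0 in auto)
  then show ?thesis using \<delta>(1)[OF i0] by (auto simp: close_def)
qed

subsection \<open>Duplicator on the compressed cylinder\<close>

text \<open>A cut moves by at most \<open>4 * k\<close> per round, so the distance
  \<open>4 * k * r\<close> from the gadget with the violated equation lasts for \<open>r\<close>
  rounds. If the pebbles form no cut, the last condition is void.\<close>

definition strat :: "nat \<Rightarrow> cblock set \<Rightarrow> cvar set \<Rightarrow> bool" where
  "strat r S f \<longleftrightarrow> S \<subseteq> blocks \<and> (\<exists>s i. i < k \<and> Gad s i \<notin> S \<and> (\<forall>b\<in>blocks. sat f b \<longleftrightarrow> b \<noteq> Gad s i) \<and>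
     (\<forall>j. near S j \<longrightarrow> \<not> close L (4 * int k * int r) j (J s)))"

lemma strat_sat: "strat r S f \<Longrightarrow> b \<in> S \<Longrightarrow> sat f b"
  by (auto simp: strat_def)

lemma strat_mono: "strat r S f \<Longrightarrow> S' \<subseteq> S \<Longrightarrow> strat r S' f"
  unfolding strat_def using near_mono by (meson in_mono subset_trans)

lemma strat_empty: "strat r {} {}"
proof -
  have "\<not> near {} j" for j using k_ge2 by (auto simp: near_def pebbles_def intro!: exI[of _ 0])
  moreover have "sat {} b \<longleftrightarrow> b \<noteq> Gad False 0" for b by (simp add: sat_def charge_def)
  moreover have "0 < k" using k_ge2 by simp
  ultimately show ?thesis unfolding strat_def by (intro conjI exI[of _ False] exI[of _ 0]) auto
qed

text \<open>A fully pebbled gadget would itself be a cut at distance 0. Hence gadget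
  \<open>s\<close> has a block outside \<open>T\<close>, to which the violated equation can
  move.\<close>

lemma move_defect:
  assumes i: "i < k" "Gad s i \<notin> S" and f: "\<And>b. b \<in> blocks \<Longrightarrow> sat f b \<longleftrightarrow> b \<noteq> Gad s i"
    and T: "S \<subseteq> T" "T \<subseteq> blocks"
    and far: "\<And>j. near T j \<Longrightarrow> \<not> close L (4 * int k * int r) j (J s)"
  shows "\<exists>f'. (\<forall>b\<in>S. f' \<inter> nb b = f \<inter> nb b) \<and> strat r T f'"
proof -
  have "\<not> near T (J s)" using far close_refl by force
  then obtain i' where i': "i' < k" "Gad s i' \<notin> T" using near_gadget[of s T] by blast
  have X: "{i} = {i. i < k \<and> \<not> sat f (Gad s i)}" using i f Gad_blocks by auto
  have "\<exists>f'. (\<forall>b\<in>S. f' \<inter> nb b = f \<inter> nb b) \<and> (\<forall>b. (\<forall>i. b \<noteq> Gad s i) \<longrightarrow> sat f' b = sat f b) \<and>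
      (\<forall>j<k. sat f' (Gad s j) \<longleftrightarrow> \<not> (j = i' \<and> odd (card {i})))"
    by (rule merge_defects[OF i'(1) _ X]) (use i i' T in auto)
  then obtain f' where f': "\<forall>b\<in>S. f' \<inter> nb b = f \<inter> nb b" "\<forall>b. (\<forall>i. b \<noteq> Gad s i) \<longrightarrow> sat f' b = sat f b"
      "\<forall>j<k. sat f' (Gad s j) \<longleftrightarrow> \<not> (j = i' \<and> odd (card {i}))"
    by blast
  have "sat f' b \<longleftrightarrow> b \<noteq> Gad s i'" if b: "b \<in> blocks" for b
  proof (cases "\<exists>j. b = Gad s j")
    case True
    then show ?thesis using b f'(3) Gad_blocks by auto
  next
    case False
    then show ?thesis using f'(2) f[OF b] by auto
  qed
  then show ?thesis using f'(1) i' T far unfolding strat_def by blast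
qed

text \<open>The flow flips an odd number of equations in each gadget, all at unpebbled blocks. With
  the old defect this makes an even number in gadget \<open>s\<close>, which cancel, and an odd
  number in the other one, which merge into one.\<close>

lemma switch_gadget:
  assumes i: "i < k" "Gad s i \<notin> S" and f: "\<And>b. b \<in> blocks \<Longrightarrow> sat f b \<longleftrightarrow> b \<noteq> Gad s i"
    and S: "S \<subseteq> blocks" and flow: "unit_flow S F"
  shows "\<exists>f' i'. (\<forall>b\<in>S. f' \<inter> nb b = f \<inter> nb b) \<and> i' < k \<and> Gad s' i' \<notin> S \<and>
    (\<forall>b\<in>blocks. sat f' b \<longleftrightarrow> b \<noteq> Gad s' i')"
proof (cases "s' = s")
  case True
  then show ?thesis using i f by blast
next
  case False
  let ?Y = "\<lambda>s. {r. r < k \<and> Hor r (J s mod m r) \<in> F}"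
  have oddY: "odd (card (?Y s))" for s using flow by (simp add: unit_flow_def)
  have flowS: "F \<inter> nb b = {}" if "b \<in> S" for b
    using flow that unfolding unit_flow_def by blast
  have Ypeb: "Gad s r \<notin> S" if "r \<in> ?Y s" for r s
    using flowS[of "Gad s r"] that by auto
  define f1 where "f1 = sym_diff f F"
  have f1S: "\<forall>b\<in>S. f1 \<inter> nb b = f \<inter> nb b"
    using flow agree_sym_diff unfolding f1_def unit_flow_def by blast
  have f1_Gad: "sat f1 (Gad u r) \<longleftrightarrow> (sat f (Gad u r) \<longleftrightarrow> r \<notin> ?Y u)" if "r < k" for u r
  proof -
    have "odd (card (F \<inter> nb (Gad u r))) \<longleftrightarrow> r \<in> ?Y u"
      using gad_parity[of F u r] flow that by (simp add: unit_flow_def del: nb.simps)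
    then show ?thesis unfolding f1_def sat_sym_diff by blast
  qed
  have f1_else: "sat f1 b" if b: "b \<in> blocks" "\<forall>u r. b \<noteq> Gad u r" for b
  proof -
    have "even (card (F \<inter> nb b))"
    proof (cases b)
      case (Cell r a)
      then show ?thesis using flow b by (simp add: unit_flow_def Cell_blocks del: nb.simps)
    next
      case (Pad j)
      then have "F \<inter> nb b = {}" using flow by (auto simp: unit_flow_def)
      then show ?thesis by simp
    qed (use b in blast)
    then show ?thesis using f[OF b(1)] b(2) unfolding f1_def sat_sym_diff by blast
  qed
  define X where "X = {r. r < k \<and> \<not> sat f1 (Gad s r)}"
  have Xeq: "X = sym_diff {i} (?Y s)" using i f f1_Gad Gad_blocks by (auto simp: X_def)
  have evenX: "even (card X)" unfolding Xeq using oddY[of s] by (subst even_card_sym_diff) auto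
  have Xpeb: "Gad s r \<notin> S" if "r \<in> X" for r using that Ypeb[of r s] i unfolding Xeq by blast
  obtain f2 where f2: "\<forall>b\<in>S. f2 \<inter> nb b = f1 \<inter> nb b" "\<forall>b. (\<forall>i. b \<noteq> Gad s i) \<longrightarrow> sat f2 b = sat f1 b"
      "\<forall>r<k. sat f2 (Gad s r)"
    using merge_defects[OF i X_def Xpeb S] evenX by auto
  have X': "?Y s' = {r. r < k \<and> \<not> sat f2 (Gad s' r)}"
  proof -
    have "sat f2 (Gad s' r) \<longleftrightarrow> r \<notin> ?Y s'" if "r < k" for r
      using f2(2) False f1_Gad[OF that, of s'] f[of "Gad s' r"] that by (auto simp: Gad_blocks)
    then show ?thesis by auto
  qed
  have "?Y s' \<noteq> {}" using oddY[of s'] by (metis card.empty even_zero)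
  then obtain i' where i': "i' \<in> ?Y s'" by blast
  have i'k: "i' < k" "Gad s' i' \<notin> S" using i' Ypeb by auto
  obtain f3 where f3: "\<forall>b\<in>S. f3 \<inter> nb b = f2 \<inter> nb b" "\<forall>b. (\<forall>i. b \<noteq> Gad s' i) \<longrightarrow> sat f3 b = sat f2 b"
      "\<forall>r<k. sat f3 (Gad s' r) \<longleftrightarrow> r \<noteq> i'"
    using merge_defects[OF i'k X' Ypeb S] oddY[of s'] by auto
  have "sat f3 b \<longleftrightarrow> b \<noteq> Gad s' i'" if b: "b \<in> blocks" for b
  proof (cases "\<exists>u r. b = Gad u r")
    case True
    then obtain u r where ur: "b = Gad u r" by blast
    then have r: "r < k" using b Gad_blocks by simp
    show ?thesis
    proof (cases "u = s'")
      case True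
      then show ?thesis using f3(3) r ur by simp
    next
      case u: False
      then have us: "u = s" using False by blast
      have "sat f3 b = sat f2 b" using f3(2) u ur by blast
      then show ?thesis using f2(3) r ur us u by simp
    qed
  next
    case no: False
    then have "sat f3 b = sat f1 b" using f3(2) f2(2) by blast
    then show ?thesis using f1_else[OF b] no by blast
  qed
  then show ?thesis using f1S f2(1) f3(1) i'k by (metis (no_types, lifting))
qed

text \<open>If \<open>S\<close> is a cut, the cuts of \<open>T\<close> stay near it and the defect
  stays in its gadget. Otherwise \<open>S\<close> admits a flow, while \<open>T\<close> may already
  be a cut; its position is unique up to \<open>4 * k\<close>, so one gadget is far from it, and the
  defect is sent there before the pebbles of \<open>T\<close> are placed.\<close>

lemma strat_extend:
  assumes st: "strat (Suc r) S f" and T: "S \<subseteq> T" "T \<subseteq> blocks" "card T \<le> k + c"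
    and far: "\<not> close L (8 * int k * (int r + 1)) (J False) (J True)"
  shows "\<exists>f'. (\<forall>b\<in>S. f' \<inter> nb b = f \<inter> nb b) \<and> strat r T f'"
proof -
  obtain s i where i: "i < k" "Gad s i \<notin> S" and f: "\<And>b. b \<in> blocks \<Longrightarrow> sat f b \<longleftrightarrow> b \<noteq> Gad s i"
    and fS: "\<And>j. near S j \<Longrightarrow> \<not> close L (4 * int k * int (Suc r)) j (J s)"
    using st unfolding strat_def by blast
  show ?thesis
  proof (cases "\<exists>j. near S j")
    case True
    then obtain j where j: "near S j" by blast
    have "\<not> close L (4 * int k * int r) j' (J s)" if j': "near T j'" for j'
    proof
      assume c: "close L (4 * int k * int r) j' (J s)"
      have "close L (4 * int k) j j'" by (rule near_unique[OF T(2,3) near_mono[OF j T(1)] j'])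
      from close_trans[OF this c] have "close L (4 * int k * int (Suc r)) j (J s)"
        by (simp add: algebra_simps)
      then show False using fS j by blast
    qed
    from move_defect[OF i f T(1,2) this] show ?thesis by blast
  next
    case False
    have finT: "finite T" using T(2) finite_blocks finite_subset by blast
    have "\<exists>s'. \<forall>j. near T j \<longrightarrow> \<not> close L (4 * int k * int r) j (J s')"
    proof (rule ccontr)
      assume "\<not> ?thesis"
      then obtain j j' where j: "near T j" "close L (4 * int k * int r) j (J False)"
          "near T j'" "close L (4 * int k * int r) j' (J True)" by blast
      have cl: "close L (4 * int k) j j'" by (rule near_unique[OF T(2,3) j(1,3)])
      have "4 * int k * int r + (4 * int k + 4 * int k * int r) \<le> 8 * int k * (int r + 1)"
        by (simp add: algebra_simps)
      from close_mono[OF close_trans[OF close_sym[OF j(2)] close_trans[OF cl j(4)]] this]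
      show False using far by blast
    qed
    then obtain s' where s': "\<And>j. near T j \<Longrightarrow> \<not> close L (4 * int k * int r) j (J s')" by blast
    have S: "S \<subseteq> blocks" "card S \<le> k + c" using T card_mono[OF finT T(1)] by auto
    obtain F where "unit_flow S F" using no_flow_imp_near[OF _ S] False by blast
    from switch_gadget[OF i f S(1) this, of s']
    obtain f' i' where f': "\<forall>b\<in>S. f' \<inter> nb b = f \<inter> nb b" "i' < k" "Gad s' i' \<notin> S"
        "\<And>b. b \<in> blocks \<Longrightarrow> sat f' b \<longleftrightarrow> b \<noteq> Gad s' i'" by blast
    from move_defect[OF f'(2-4) T(1,2) s']
    obtain f'' where "\<forall>b\<in>S. f'' \<inter> nb b = f' \<inter> nb b" "strat r T f''" by blast
    then show ?thesis using f'(1) by (intro exI[of _ f'']) simp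
  qed
qed

lemma gadgets_far:
  assumes "0 \<le> d" "2 * d + 2 \<le> L"
  shows "\<not> close L d (J False) (J True)"
proof
  assume "close L d (J False) (J True)"
  then obtain \<delta> where \<delta>: "\<bar>\<delta>\<bar> \<le> d" "[0 = L div 2 + \<delta>] (mod L)" by (auto simp: close_def J_def)
  then have "L dvd L div 2 + \<delta>" using cong_dvd_iff by (metis cong_0_iff cong_sym)
  moreover have "0 < L div 2 + \<delta>" "L div 2 + \<delta> < L" using \<delta>(1) assms by linarith+
  ultimately show False using zdvd_not_zless by blast
qed

theorem not_distinguished_in:
  assumes t: "16 * int k * (int t + 1) + 2 \<le> L"
  shows "\<not> wl_distinguishes_in (k + c - 1) t G vcol H vcol"
proof (rule not_wl_distinguishes_in[where P = "\<lambda>r S f. r \<le> t \<and> strat r S f"])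
  have far: "\<not> close L (8 * int k * (int r + 1)) (J False) (J True)" if "r \<le> t" for r
  proof (rule gadgets_far)
    have "8 * int k * (int r + 1) \<le> 8 * int k * (int t + 1)" using that by (intro mult_left_mono) auto
    then show "2 * (8 * int k * (int r + 1)) + 2 \<le> L" using t by linarith
  qed auto
  show "\<exists>f'. (\<forall>b'\<in>S. f' \<inter> nb b' = f \<inter> nb b') \<and> r \<le> t \<and> strat r (insert b S) f'"
    if "Suc r \<le> t \<and> strat (Suc r) S f" "S \<subseteq> blocks" "card S \<le> k + c - 1" "b \<in> blocks" for r S f b
  proof -
    have "card (insert b S) \<le> Suc (card S)" by (rule card_insert_le_m1) auto
    then have "card (insert b S) \<le> k + c" using that c_pos by linarith
    then show ?thesis using strat_extend[of r S f "insert b S"] that far[of r] by auto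
  qed
  \<comment> \<open>An opening position arises from the empty one by placing all pebbles in one
    extension.\<close>
  show "\<exists>f. t \<le> t \<and> strat t S f" if "S \<subseteq> blocks" "card S \<le> k + c - 1" for S
    using strat_extend[OF strat_empty, of S t] that far[of t] by auto
  show "0 < k + c - 1" using c_pos k_ge2 by simp
qed (use strat_sat strat_mono in blast)+

subsection \<open>Spoiler on the compressed cylinder\<close>

lemma even_handshake:
  "even (\<Sum>i<n. card {j. j < n \<and> j \<noteq> i \<and> P {i, j}})" for n :: nat
proof -
  let ?A = "SIGMA i:{..<n}. {j. j < n \<and> j \<noteq> i \<and> P {i, j}}"
  let ?B = "{(i, j). i < j \<and> j < n \<and> P {i, j}}"
  have finB: "finite ?B" by (rule finite_subset[of _ "{..<n} \<times> {..<n}"]) auto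
  have "?A = ?B \<union> prod.swap ` ?B"
    by (auto simp: image_iff insert_commute)
  moreover have "card (?B \<union> prod.swap ` ?B) = card ?B + card (prod.swap ` ?B)"
    by (intro card_Un_disjoint finite_imageI finB) auto
  moreover have "card (prod.swap ` ?B) = card ?B" by (intro card_image) auto
  ultimately have "card ?A = 2 * card ?B" by simp
  moreover have "card ?A = (\<Sum>i<n. card {j. j < n \<and> j \<noteq> i \<and> P {i, j}})"
    by (rule card_SigmaI) auto
  ultimately show ?thesis by simp
qed

lemma odd_sum_cong:
  fixes u v :: "'a \<Rightarrow> nat"
  assumes "\<And>i. i \<in> A \<Longrightarrow> odd (u i) \<longleftrightarrow> odd (v i)"
  shows "odd (sum u A) \<longleftrightarrow> odd (sum v A)"
  using assms by (induction A rule: infinite_finite_induct) auto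

text \<open>In the sum of all equations of a gadget each inner edge cancels, so the horizontal
  variables at its column carry the charge. The sweep brings the odd parity of gadget
  \<open>False\<close> to the even one of gadget \<open>True\<close>.\<close>

lemma gadget_parity:
  assumes "\<And>i. i < k \<Longrightarrow> sat f (Gad s i)"
  shows "odd (\<Sum>i<k. of_bool (Hor i (J s mod m i) \<in> f) :: nat) \<longleftrightarrow> \<not> s"
proof -
  let ?e = "\<lambda>i. card {j. j < k \<and> j \<noteq> i \<and> Edge s {i, j} \<in> f}"
  have "odd (of_bool (Hor i (J s mod m i) \<in> f) + ?e i) \<longleftrightarrow> odd (of_bool (\<not> s \<and> i = 0) :: nat)" if "i < k" for i
    using assms[OF that] gad_parity[of f s i] unfolding sat_def charge_def by auto
  then have "odd (\<Sum>i<k. of_bool (Hor i (J s mod m i) \<in> f) + ?e i) \<longleftrightarrow> odd (\<Sum>i<k. of_bool (\<not> s \<and> i = 0) :: nat)"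
    by (intro odd_sum_cong) auto
  moreover have "(\<Sum>i<k. of_bool (\<not> s \<and> i = 0) :: nat) = of_bool (\<not> s)"
    using k_ge2 by (cases k) (simp_all add: sum.lessThan_Suc_shift)
  moreover have "even (\<Sum>i<k. ?e i)" by (rule even_handshake)
  ultimately show ?thesis by (auto simp: sum.distrib)
qed

section \<open>Sweeping through the unrolled cylinder\<close>

definition hor :: "nat \<Rightarrow> nat \<Rightarrow> cvar" where "hor i j = Hor i (int j mod m i)"
definition ver :: "nat \<Rightarrow> nat \<Rightarrow> cvar" where "ver i j = Ver i (int j mod g i)"

text \<open>The block of row \<open>i\<close> whose right end is column \<open>j\<close>.\<close>

definition blk :: "nat \<Rightarrow> nat \<Rightarrow> cblock" where
  "blk i j = (if j = 0 then Gad False i else Cell i ((int j - 1) mod m i))"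

lemma nb_blk_Suc:
  assumes "i < k"
  shows "nb (blk i (Suc j)) = {hor i j, hor i (Suc j), ver i j, ver (prv i) j}"
proof -
  have "g i dvd m i" "g (prv i) dvd m i" using nxt_prv[OF assms] by (simp_all add: g_def)
  then show ?thesis
    by (simp add: blk_def hor_def ver_def mod_mod_cancel mod_simps add.commute)
qed

lemma blk_blocks: "i < k \<Longrightarrow> blk i j \<in> blocks"
  using m_gt1[of i] by (simp add: blk_def Gad_blocks Cell_blocks)

lemma hor_in_blk: "i < k \<Longrightarrow> hor i j \<in> nb (blk i j)"
  by (cases j) (simp add: blk_def hor_def J_def, simp add: nb_blk_Suc del: nb.simps)

lemma sat_blk_Suc:
  assumes i: "i < k" and s: "sat f (blk i (Suc j))"
  shows "even (of_bool (hor i j \<in> f) + of_bool (hor i (Suc j) \<in> f) + of_bool (ver i j \<in> f) +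
    of_bool (ver (prv i) j \<in> f) :: nat)"
proof -
  let ?a = "int j mod m i"
  have b: "blk i (Suc j) = Cell i ?a" by (simp add: blk_def)
  have dvd: "g i dvd m i" "g (prv i) dvd m i" using nxt_prv[OF i] by (simp_all add: g_def)
  have "even (card (f \<inter> nb (Cell i ?a)))" using s unfolding b sat_def charge_def by simp
  then show ?thesis
    using cell_parity[OF i, of f ?a] dvd
    by (simp add: hor_def ver_def mod_mod_cancel mod_simps add.commute del: nb.simps)
qed

text \<open>Rows below \<open>s\<close> have already advanced from column \<open>j\<close> to column \<open>j + 1\<close>; the sum counts the
  variables on the boundary of the swept region.\<close>

definition front :: "nat \<Rightarrow> nat \<Rightarrow> cblock list" where
  "front j s = map (\<lambda>i. blk i (if i < s then Suc j else j)) [0..<k]"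

definition front_parity :: "nat \<Rightarrow> nat \<Rightarrow> cvar set \<Rightarrow> bool" where
  "front_parity j s f \<longleftrightarrow> odd ((\<Sum>i<k. of_bool (hor i (if i < s then Suc j else j) \<in> f)) +
     (if 0 < s \<and> s < k then of_bool (ver (s - 1) j \<in> f) + of_bool (ver (k - 1) j \<in> f) else 0) :: nat)"

text \<open>Old boundary variables lie in pebbled blocks and keep their values. Advancing in row
  \<open>s\<close> changes the boundary by the four variables of one cell, whose equation is
  even.\<close>

lemma front_step:
  assumes r: "reach (front j s) f" and p: "front_parity j s f" and s: "s < k"
  shows "\<exists>f'. reach (front j (Suc s)) f' \<and> front_parity j (Suc s) f'"
proof -
  have sub: "set (front j s) \<subseteq> blocks" by (auto simp: front_def blk_blocks)
  have len: "length (front j s) = k" by (simp add: front_def)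
  have upd: "(front j s)[s := blk s (Suc j)] = front j (Suc s)"
    using s by (intro nth_equalityI) (auto simp: front_def nth_list_update)
  have "\<exists>f'. (\<forall>b\<in>set (front j s). f' \<inter> nb b = f \<inter> nb b) \<and> sat f' (blk s (Suc j)) \<and>
      (\<forall>i<length (front j s). reach ((front j s)[i := blk s (Suc j)]) f')"
    by (rule reach_step[OF r sub _ blk_blocks[OF s]]) (simp add: len k_ge2)
  then obtain f' where f': "\<forall>b\<in>set (front j s). f' \<inter> nb b = f \<inter> nb b" "sat f' (blk s (Suc j))"
      "\<forall>i<k. reach ((front j s)[i := blk s (Suc j)]) f'"
    unfolding len by blast
  have same: "x \<in> f' \<longleftrightarrow> x \<in> f" if "i < k" "x \<in> nb (blk i (if i < s then Suc j else j))" for i x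
  proof -
    have "blk i (if i < s then Suc j else j) \<in> set (front j s)" using that by (auto simp: front_def)
    then show ?thesis using f'(1) that by blast
  qed
  have h: "hor i (if i < s then Suc j else j) \<in> f' \<longleftrightarrow> hor i (if i < s then Suc j else j) \<in> f" if "i < k" for i
    by (rule same[OF that hor_in_blk[OF that]])
  have v1: "ver (s - 1) j \<in> f' \<longleftrightarrow> ver (s - 1) j \<in> f" if "0 < s"
    using same[of "s - 1" "ver (s - 1) j"] that s nb_blk_Suc[of "s - 1" j] by (simp del: nb.simps)
  have v2: "ver (k - 1) j \<in> f' \<longleftrightarrow> ver (k - 1) j \<in> f" if "0 < s"
    using same[of 0 "ver (k - 1) j"] that s nb_blk_Suc[of 0 j] by (simp add: prv_def del: nb.simps)
  have hs: "hor s j \<in> f' \<longleftrightarrow> hor s j \<in> f" using h[OF s] by simp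
  let ?S = "\<lambda>f t. (\<Sum>i<k. of_bool (hor i (if i < t then Suc j else j) \<in> f) :: nat)"
  let ?R = "(\<Sum>i\<in>{..<k} - {s}. of_bool (hor i (if i < s then Suc j else j) \<in> f) :: nat)"
  have old: "?S f s = of_bool (hor s j \<in> f) + ?R"
    using s by (subst sum.remove[of _ s]) auto
  have "?S f' (Suc s) = of_bool (hor s (Suc j) \<in> f') +
      (\<Sum>i\<in>{..<k} - {s}. of_bool (hor i (if i < Suc s then Suc j else j) \<in> f'))"
    using s by (subst sum.remove[of _ s]) auto
  also have "(\<Sum>i\<in>{..<k} - {s}. of_bool (hor i (if i < Suc s then Suc j else j) \<in> f')) = ?R"
  proof (rule sum.cong)
    fix i assume "i \<in> {..<k} - {s}"
    then have "i < k" "(i < Suc s) = (i < s)" by auto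
    then show "of_bool (hor i (if i < Suc s then Suc j else j) \<in> f') =
        (of_bool (hor i (if i < s then Suc j else j) \<in> f) :: nat)" using h by simp
  qed simp
  finally have new: "?S f' (Suc s) = of_bool (hor s (Suc j) \<in> f') + ?R" .
  have loc: "even (of_bool (hor s j \<in> f) + of_bool (hor s (Suc j) \<in> f') + of_bool (ver s j \<in> f') +
      of_bool (ver (prv s) j \<in> f') :: nat)"
    using sat_blk_Suc[OF s f'(2)] hs by simp
  let ?V = "\<lambda>f t. (if 0 < t \<and> t < k then of_bool (ver (t - 1) j \<in> f) + of_bool (ver (k - 1) j \<in> f) else 0) :: nat"
  \<comment> \<open>The vertical boundary opens at row 0, moves on in the middle rows and closes at
    row \<open>k - 1\<close>.\<close>
  have vert: "even (?V f s + ?V f' (Suc s) + of_bool (ver s j \<in> f') + of_bool (ver (prv s) j \<in> f'))"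
  proof -
    consider "s = 0" | "0 < s" "Suc s < k" | "0 < s" "s = k - 1" using s by linarith
    then show ?thesis
    proof cases
      case 1
      then show ?thesis using k_ge2 by (simp add: prv_def)
    next
      case 2
      then show ?thesis using v1 v2 by (simp add: prv_def)
    next
      case 3
      then show ?thesis using v1 v2 s by (simp add: prv_def)
    qed
  qed
  have "odd (of_bool (hor s j \<in> f) + ?R + ?V f s)"
    using p unfolding front_parity_def old .
  with loc vert have "odd (of_bool (hor s (Suc j) \<in> f') + ?R + ?V f' (Suc s))"
    unfolding even_add by argo
  then have "front_parity j (Suc s) f'"
    unfolding front_parity_def new .
  then show ?thesis using f'(3) s upd by metis
qed

lemma front_reach:
  assumes start: "\<exists>f. reach (front 0 0) f \<and> front_parity 0 0 f"
  shows "\<exists>f. reach (front j 0) f \<and> front_parity j 0 f"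
proof (induction j)
  case (Suc j)
  have "s \<le> k \<Longrightarrow> \<exists>f. reach (front j s) f \<and> front_parity j s f" for s
  proof (induction s)
    case (Suc s)
    then show ?case using front_step[of j s] by force
  qed (use Suc in simp)
  moreover have "front j k = front (Suc j) 0" by (simp add: front_def)
  moreover have "front_parity j k f \<longleftrightarrow> front_parity (Suc j) 0 f" for f
    by (simp add: front_parity_def)
  ultimately show ?case by (metis order_refl)
qed (rule start)

text \<open>The blocks of the second gadget contain the same horizontal variables as the front at
  its column, so exchanging them one by one preserves the parity.\<close>

lemma front_end:
  fixes j :: nat
  defines "e s \<equiv> map (\<lambda>i. if i < s then Gad True i else blk i j) [0..<k]"
  assumes j: "int j = J True" and r: "reach (e s) f" "odd (\<Sum>i<k. of_bool (hor i j \<in> f) :: nat)" and s: "s < k"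
  shows "\<exists>f'. reach (e (Suc s)) f' \<and> odd (\<Sum>i<k. of_bool (hor i j \<in> f') :: nat)"
proof -
  have sub: "set (e s) \<subseteq> blocks" by (auto simp: e_def blk_blocks Gad_blocks)
  have len: "length (e s) = k" by (simp add: e_def)
  have upd: "(e s)[s := Gad True s] = e (Suc s)"
    using s by (intro nth_equalityI) (auto simp: e_def nth_list_update)
  obtain f' where f': "\<forall>b\<in>set (e s). f' \<inter> nb b = f \<inter> nb b"
      "\<forall>i<k. reach ((e s)[i := Gad True s]) f'"
    using reach_step[OF r(1) sub, of "Gad True s"] len k_ge2 s by (auto simp: Gad_blocks)
  have "hor i j \<in> f' \<longleftrightarrow> hor i j \<in> f" if i: "i < k" for i
  proof -
    have "(if i < s then Gad True i else blk i j) \<in> set (e s)" using i by (auto simp: e_def)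
    moreover have "hor i j \<in> nb (if i < s then Gad True i else blk i j)"
    proof (cases "i < s")
      case True
      then show ?thesis by (simp add: hor_def j)
    next
      case False
      then show ?thesis using hor_in_blk[OF i] by simp
    qed
    ultimately show ?thesis using f'(1) by blast
  qed
  then show ?thesis using r(2) f'(2) s upd by (intro exI[of _ f']) auto
qed

theorem distinguished: "wl_distinguishes k G vcol H vcol"
proof (rule ccontr)
  assume nd: "\<not> ?thesis"
  define j where "j = nat (J True)"
  have "0 \<le> p l" if "l < k" for l using p_gt[OF that] by linarith
  then have "0 \<le> L" unfolding L_def using W_pos by (intro mult_nonneg_nonneg prod_nonneg) auto
  then have j: "int j = J True" by (simp add: j_def J_def)
  have "set (front 0 0) \<subseteq> blocks" "length (front 0 0) = k" by (auto simp: front_def blk_blocks)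
  from reach_init[OF nd this] obtain f where f: "reach (front 0 0) f" by blast
  then have "sat f (Gad False i)" if "i < k" for i
    using that by (auto simp: reach_def front_def blk_def)
  from gadget_parity[OF this] have "front_parity 0 0 f"
    by (simp add: front_parity_def hor_def J_def)
  then obtain f1 where f1: "reach (front j 0) f1" "front_parity j 0 f1"
    using front_reach f by blast
  define e where "e s = map (\<lambda>i. if i < s then Gad True i else blk i j) [0..<k]" for s
  have "s \<le> k \<Longrightarrow> \<exists>f. reach (e s) f \<and> odd (\<Sum>i<k. of_bool (hor i j \<in> f) :: nat)" for s
  proof (induction s)
    case 0
    have "e 0 = front j 0" by (simp add: e_def front_def)
    then show ?case using f1 by (auto simp: front_parity_def)
  next
    case (Suc s)
    then show ?case using front_end[OF j, of s] unfolding e_def by auto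
  qed
  then obtain f2 where f2: "reach (e k) f2" "odd (\<Sum>i<k. of_bool (hor i j \<in> f2) :: nat)" by blast
  have "sat f2 (Gad True i)" if "i < k" for i
    using f2(1) that by (auto simp: reach_def e_def)
  from gadget_parity[OF this] show False using f2(2) j by (simp add: hor_def)
qed

subsection \<open>The number of vertices\<close>

definition core_size :: nat where
  "core_size = (\<Sum>b\<in>core. card {x. x \<subseteq> nb b \<and> even (card x)})"

lemma card_verts: "card (verts_of (\<lambda>_. False)) = core_size + npad"
proof -
  have fin: "finite {x. x \<subseteq> nb b \<and> P x}" for b P using finite_nb by simp
  have "card (verts_of (\<lambda>_. False)) = (\<Sum>b\<in>blocks. card {x. x \<subseteq> nb b \<and> even (card x)})"
    unfolding verts_of_def using finite_blocks fin by (subst card_SigmaI) auto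
  also have "\<dots> = core_size + (\<Sum>b\<in>Pad ` {..<npad}. card {x. x \<subseteq> nb b \<and> even (card x)})"
    unfolding blocks_def core_size_def using finite_blocks unfolding blocks_def
    by (intro sum.union_disjoint) (auto simp: core_def)
  also have "(\<Sum>b\<in>Pad ` {..<npad}. card {x. x \<subseteq> nb b \<and> even (card x)}) = (\<Sum>b\<in>Pad ` {..<npad}. 1)"
  proof (rule sum.cong)
    fix b assume "b \<in> Pad ` {..<npad}"
    then have "{x. x \<subseteq> nb b \<and> even (card x)} = {{}}" by (auto simp: subset_singleton_iff)
    then show "card {x. x \<subseteq> nb b \<and> even (card x)} = 1" by simp
  qed simp
  also have "\<dots> = npad" by (simp add: card_image inj_on_def)
  finally show ?thesis .
qed

lemma card_verts': "card (verts_of charge) = core_size + npad"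
proof -
  have "nb b \<noteq> {}" for b by (cases b) auto
  then show ?thesis using card_verts_of_eq[of charge "\<lambda>_. False"] card_verts by simp
qed

text \<open>A crude count of all subsets of at most four variables per cell and at most
  \<open>k\<close> per gadget block. The gadget term is independent of the moduli and is absorbed
  for large \<open>n\<close>.\<close>

lemma core_size_le: "int core_size \<le> 16 * (\<Sum>i<k. m i) + 2 * int k * 2 ^ k"
proof -
  let ?C = "(\<lambda>(i, a). Cell i a) ` (SIGMA i:{..<k}. {0..<m i})"
  let ?D = "(\<lambda>(s, i). Gad s i) ` (UNIV \<times> {..<k})"
  have le: "card {x. x \<subseteq> nb b \<and> even (card x)} \<le> 2 ^ card (nb b)" for b
  proof -
    have "card {x. x \<subseteq> nb b \<and> even (card x)} \<le> card (Pow (nb b))"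
      using finite_nb by (intro card_mono) auto
    then show ?thesis using finite_nb by (simp add: card_Pow)
  qed
  have "core_size \<le> (\<Sum>b\<in>core. 2 ^ card (nb b))"
    unfolding core_size_def by (intro sum_mono le)
  also have "\<dots> = (\<Sum>b\<in>?C. 2 ^ card (nb b)) + (\<Sum>b\<in>?D. 2 ^ card (nb b))"
    unfolding core_def by (intro sum.union_disjoint) auto
  also have "\<dots> \<le> (\<Sum>b\<in>?C. 16) + (\<Sum>b\<in>?D. 2 ^ k)"
  proof (intro add_mono sum_mono)
    fix b assume "b \<in> ?C"
    then obtain i a where "b = Cell i a" by auto
    then have nbb: "nb b = set [Hor i (a mod m i), Hor i ((a + 1) mod m i), Ver i (a mod g i), Ver (prv i) (a mod g (prv i))]"
      by simp
    have "card (nb b) \<le> 4" unfolding nbb by (rule order_trans[OF card_length]) simp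
    then have "(2::nat) ^ card (nb b) \<le> 2 ^ 4" by (intro power_increasing) auto
    then show "(2::nat) ^ card (nb b) \<le> 16" by simp
  next
    fix b assume "b \<in> ?D"
    then obtain s i where b: "b = Gad s i" "i < k" by auto
    have "{Edge s {i, j} |j. j < k \<and> j \<noteq> i} = (\<lambda>j. Edge s {i, j}) ` ({..<k} - {i})" by auto
    then have "card {Edge s {i, j} |j. j < k \<and> j \<noteq> i} \<le> card ({..<k} - {i})"
      by (simp add: card_image_le)
    then have "card (nb b) \<le> k" using b(2) by (simp add: b(1) card_insert_if)
    then show "(2::nat) ^ card (nb b) \<le> 2 ^ k" by (intro power_increasing) auto
  qed
  also have "\<dots> = card ?C * 16 + card ?D * 2 ^ k" by simp
  also have "card ?C = (\<Sum>i<k. nat (m i))"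
  proof -
    have "card ?C = card (SIGMA i:{..<k}. {0..<m i})" by (intro card_image) (auto simp: inj_on_def)
    also have "\<dots> = (\<Sum>i<k. card {0..<m i})" by (intro card_SigmaI) auto
    finally show ?thesis by simp
  qed
  also have "card ?D = 2 * k"
    by (subst card_image) (auto simp: inj_on_def card_cartesian_product card_UNIV_bool)
  finally have "int core_size \<le> int ((\<Sum>i<k. nat (m i)) * 16 + 2 * k * 2 ^ k)" by linarith
  also have "\<dots> = 16 * (\<Sum>i<k. m i) + 2 * int k * 2 ^ k"
  proof -
    have "int (nat (m i)) = m i" for i using m_gt1[of i] by simp
    then show ?thesis by (simp add: int_sum)
  qed
  finally show ?thesis .
qed

lemma m_le_power:
  fixes z :: real
  assumes p: "\<And>l. l < k \<Longrightarrow> real_of_int (p l) \<le> z" and z: "1 \<le> z" and i: "i < k"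
  shows "real_of_int (m i) \<le> W * z ^ (c + 1)"
proof -
  let ?A = "{l. l < k \<and> rk l i \<le> c}"
  have "(\<Prod>l\<in>?A. real_of_int (p l)) \<le> (\<Prod>l\<in>?A. z)"
  proof (rule prod_mono)
    fix l assume "l \<in> ?A"
    then show "0 \<le> real_of_int (p l) \<and> real_of_int (p l) \<le> z" using p p_gt[of l] by simp
  qed
  also have "\<dots> = z ^ card ?A" by simp
  also have "\<dots> \<le> z ^ (c + 1)" by (rule power_increasing[OF card_factors[OF i] z])
  finally have "real_of_int W * (\<Prod>l\<in>?A. real_of_int (p l)) \<le> W * z ^ (c + 1)"
    using W_pos by (intro mult_left_mono) auto
  then show ?thesis by (simp add: m_def)
qed

end

text \<open>As for Goedel's beta function: a common divisor is coprime to \<open>M\<close> and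
  divides \<open>M * (l - l')\<close>, hence \<open>l - l'\<close>, which divides \<open>k!\<close>
  and so \<open>M\<close>.\<close>

lemma coprime_progression:
  fixes M y :: int and k l l' :: nat
  assumes "int (fact k) dvd M" "l \<le> k" "l' \<le> k" "l \<noteq> l'"
  shows "coprime (M * (y + int l) + 1) (M * (y + int l') + 1)"
proof (rule coprimeI)
  fix d assume d: "d dvd M * (y + int l) + 1" "d dvd M * (y + int l') + 1"
  have cop: "coprime d M"
  proof (rule coprimeI)
    fix e assume "e dvd d" "e dvd M"
    then have "e dvd M * (y + int l) + 1" "e dvd M * (y + int l)" using d(1) dvd_trans by auto
    then show "is_unit e" using dvd_add_right_iff by blast
  qed
  have "(M * (y + int l) + 1) - (M * (y + int l') + 1) = M * (int l - int l')" by (simp add: algebra_simps)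
  then have "d dvd M * (int l - int l')" using dvd_diff[OF d] by simp
  then have "d dvd int l - int l'" by (simp only: coprime_dvd_mult_right_iff[OF cop])
  moreover have "int l - int l' dvd M"
  proof -
    have "nat \<bar>int l - int l'\<bar> dvd fact k" using assms by (intro dvd_fact) auto
    then have "int (nat \<bar>int l - int l'\<bar>) dvd int (fact k)" by (simp only: of_nat_dvd_iff)
    then have "int l - int l' dvd int (fact k)" by simp
    then show ?thesis using assms(1) dvd_trans by blast
  qed
  ultimately have "d dvd M" using dvd_trans by blast
  then show "is_unit d" by (rule coprime_common_divisor[OF cop dvd_refl])
qed

lemma coprime_progression_modulus: "coprime M (M * z + 1)" for M z :: int
proof (rule coprimeI)
  fix e assume "e dvd M" "e dvd M * z + 1"
  then show "is_unit e" using dvd_add_right_iff[of e "M * z" 1] by simp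
qed

section \<open>Choice of the parameters\<close>

theorem mainTheorem5:
  fixes c k :: nat
  assumes "1 \<le> c" and "c \<le> k - 1"
  shows "\<exists>n0. \<forall>n\<ge>n0.
    \<exists>(G :: nat pair_pre_digraph) (colG :: nat \<Rightarrow> nat)
     (H :: nat pair_pre_digraph) (colH :: nat \<Rightarrow> nat).
      pair_graph G \<and> pair_graph H \<and>
      card (pverts G) = n \<and> card (pverts H) = n \<and>
      wl_distinguishes k G colG H colH \<and>
      (\<forall>t::nat. real t < (2 powr (- real (c + 10)) * real k powr (- 3) * real n)
                           powr (real k / real (c + 1)) \<longrightarrow>
         \<not> wl_distinguishes_in (k + c - 1) t G colG H colH)"
proof -
  have k: "2 \<le> k" "c < k" using assms by auto
  \<comment> \<open>Larger than \<open>8 * k\<close>, and large enough that \<open>L\<close> is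
    twice the \<open>16 * k\<close> per round required for Duplicator.\<close>
  define W where "W = 32 * int k"
  \<comment> \<open>The factorial makes the factors pairwise coprime, and \<open>W\<close> makes
    them coprime to \<open>W\<close>.\<close>
  define M where "M = W * int (fact k)"
  have W0: "0 < W" using k by (simp add: W_def)
  have M0: "0 < M" using W0 by (simp add: M_def)
  \<comment> \<open>The bound \<open>x + M * k + 1\<close> on the factors is at most
    \<open>2 * x\<close> once \<open>C \<le> x\<close>; the second term of \<open>n0\<close> pays
    for the gadgets.\<close>
  define C where "C = real_of_int M * k + 2"
  define n0 where "n0 = nat \<lceil>max (C ^ (c + 1) * (2 ^ (c + 10) * real k ^ 3)) (4 * real k * 2 ^ k)\<rceil>"
  show ?thesis
  proof (intro exI[of _ n0] allI impI)
    fix n assume n: "n0 \<le> n"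
    then have n1: "C ^ (c + 1) * (2 ^ (c + 10) * real k ^ 3) \<le> n" and n2: "4 * real k * 2 ^ k \<le> n"
      unfolding n0_def by linarith+
    define X where "X = 2 powr (- real (c + 10)) * real k powr (- 3) * real n"
    have X: "X = real n / (2 ^ (c + 10) * real k ^ 3)"
    proof -
      have "(2::real) powr (- real (c + 10)) = 1 / 2 ^ (c + 10)"
        by (simp only: powr_minus_divide powr_realpow[of 2, simplified])
      moreover have "real k powr (- 3) = 1 / real k ^ 3"
        using k by (simp add: powr_minus_divide)
      ultimately show ?thesis by (simp add: X_def)
    qed
    \<comment> \<open>The size of a factor: its power \<open>c + 1\<close> governs the number of
      vertices, its power \<open>k\<close> is the number of rounds.\<close>
    define x where "x = X powr (1 / real (c + 1))"
    have C2: "2 \<le> C" using M0 by (simp add: C_def)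
    have CX: "C ^ (c + 1) \<le> X"
      using n1 k by (simp add: X field_simps)
    have X0: "0 < X" using CX C2 zero_less_power[of C "c + 1"] by linarith
    have Cx: "C \<le> x"
    proof -
      have "C = C powr (real (c + 1) * (1 / real (c + 1)))" using C2 by simp
      also have "\<dots> = (C ^ (c + 1)) powr (1 / real (c + 1))"
        using C2 by (simp only: powr_powr[symmetric] powr_realpow[of C "c + 1"])
      also have "\<dots> \<le> x" unfolding x_def using CX C2 by (intro powr_mono2) auto
      finally show ?thesis .
    qed
    have x0: "0 < x" using Cx C2 by linarith
    have xX: "x ^ (c + 1) = X"
    proof -
      have "x ^ (c + 1) = x powr real (c + 1)" by (rule powr_realpow[OF x0, symmetric])
      also have "\<dots> = X powr (1 / real (c + 1) * real (c + 1))" by (simp only: x_def powr_powr)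
      also have "\<dots> = X" using X0 by simp
      finally show ?thesis .
    qed
    have xk: "x ^ k = X powr (real k / real (c + 1))"
      using X0 x0 by (simp add: powr_realpow[symmetric] x_def powr_powr del: of_nat_Suc)
    define y where "y = \<lceil>x / M\<rceil>"
    define p where "p l = M * (y + int l) + 1" for l
    have p_ge: "x \<le> p l" for l
    proof -
      have "x = M * (x / M)" using M0 by simp
      also have "\<dots> \<le> M * real_of_int (y + int l)"
        using M0 unfolding y_def by (intro mult_left_mono) (simp_all, linarith)
      also have "\<dots> \<le> p l" by (simp add: p_def)
      finally show ?thesis .
    qed
    have p_le: "p l \<le> 2 * x" if "l < k" for l
    proof -
      have "real_of_int (y + int l) \<le> x / M + real k"
        using that unfolding y_def by (simp, linarith)
      then have "M * real_of_int (y + int l) \<le> M * (x / M + real k)"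
        using M0 by (intro mult_left_mono) auto
      also have "\<dots> = x + M * real k" using M0 by (simp add: distrib_left)
      finally have "real_of_int (p l) \<le> x + M * real k + 1" by (simp add: p_def)
      also have "\<dots> \<le> 2 * x" using Cx unfolding C_def by linarith
      finally show ?thesis .
    qed
    have p1: "1 < p l" for l using p_ge[of l] Cx C2 by linarith
    have cyl: "compressed_cylinder k c p W"
    proof
      show "coprime (p l) (p l')" if "l < k" "l' < k" "l \<noteq> l'" for l l'
        unfolding p_def using that by (intro coprime_progression[of k]) (auto simp: M_def)
      show "coprime W (p l)" for l
        using coprime_progression_modulus[of M "y + int l"] coprime_divisors[of W M "p l" "p l"]
        unfolding p_def M_def by simp
      show "8 * int k < W" using k by (simp add: W_def)
    qed (use assms k p1 in auto)
    \<comment> \<open>\<open>core_size\<close> does not involve \<open>npad\<close>, so the unpadded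
      instance tells how many pads are missing.\<close>
    interpret base: compressed_cylinder k c 0 p W by (rule cyl)
    have "real base.core_size \<le> n"
    proof -
      have m: "base.m i \<le> W * (2 * x) ^ (c + 1)" if "i < k" for i
        by (rule base.m_le_power[OF p_le _ that]) (use Cx C2 in auto)
      have "(\<Sum>i<k. real_of_int (base.m i)) \<le> (\<Sum>i<k. W * (2 * x) ^ (c + 1))"
        using m by (intro sum_mono) auto
      also have "\<dots> = real k * (32 * real k * (2 ^ (c + 1) * X))"
        using xX by (simp add: W_def power_mult_distrib)
      \<comment> \<open>Origin of the constants:
        \<open>16 * 32 * 2 ^ (c + 1) = 2 ^ (c + 10)\<close>, with 16 solutions per cell and 32 from
        \<open>W\<close>. Two factors \<open>k\<close> come from the rows and \<open>W\<close>; the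
        third leaves \<open>n / k \<le> n / 2\<close> for the cells.\<close>
      also have "\<dots> = n / (16 * real k)"
        using k by (simp add: X power_add power2_eq_square power3_eq_cube field_simps)
      also have "\<dots> \<le> n / 32" using k by (intro divide_left_mono) auto
      finally have "16 * (\<Sum>i<k. real_of_int (base.m i)) \<le> n / 2" by simp
      moreover have "real base.core_size \<le> 16 * (\<Sum>i<k. real_of_int (base.m i)) + 2 * real k * 2 ^ k"
      proof -
        have "real_of_int (int base.core_size) \<le> real_of_int (16 * (\<Sum>i<k. base.m i) + 2 * int k * 2 ^ k)"
          using base.core_size_le by (simp only: of_int_le_iff)
        then show ?thesis by simp
      qed
      ultimately show ?thesis using n2 by linarith
    qed
    then have core: "base.core_size \<le> n" by simp
    interpret cyl: compressed_cylinder k c "n - base.core_size" p W by (rule cyl)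
    obtain G' :: "nat pair_pre_digraph" and colG and H' :: "nat pair_pre_digraph" and colH
      where copy: "pair_graph G'" "pair_graph H'" "card (pverts G') = n" "card (pverts H') = n"
        "\<And>d t. wl_distinguishes_in d t G' colG H' colH \<longleftrightarrow>
          wl_distinguishes_in d t cyl.G cyl.vcol cyl.H cyl.vcol"
      using cyl.ex_nat_copy core unfolding cyl.card_verts cyl.card_verts' by auto
    have "wl_distinguishes k G' colG H' colH"
      using cyl.distinguished by (simp add: wl_distinguishes_def copy(5))
    moreover have "\<not> wl_distinguishes_in (k + c - 1) t G' colG H' colH"
      if t: "real t < X powr (real k / real (c + 1))" for t
      unfolding copy(5)
    proof (rule cyl.not_distinguished_in)
      have "x ^ k = (\<Prod>l<k. x)" by simp
      also have "\<dots> \<le> (\<Prod>l<k. real_of_int (p l))" using p_ge x0 by (intro prod_mono) auto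
      finally have "real t < real_of_int (\<Prod>l<k. p l)" using t xk by simp
      then have "int t + 1 \<le> (\<Prod>l<k. p l)" by linarith
      then have "16 * int k * (int t + 1) \<le> 16 * int k * (\<Prod>l<k. p l)" and "1 \<le> (\<Prod>l<k. p l)"
        using k by (auto intro: mult_left_mono)
      moreover from this(2) have "16 * int k * 1 \<le> 16 * int k * (\<Prod>l<k. p l)"
        by (intro mult_left_mono) auto
      moreover have "cyl.L = 2 * (16 * int k * (\<Prod>l<k. p l))" unfolding cyl.L_def by (simp add: W_def)
      ultimately show "16 * int k * (int t + 1) + 2 \<le> cyl.L" using k by linarith
    qed
    ultimately show "\<exists>(G :: nat pair_pre_digraph) (colG :: nat \<Rightarrow> nat)
       (H :: nat pair_pre_digraph) (colH :: nat \<Rightarrow> nat).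
        pair_graph G \<and> pair_graph H \<and>
        card (pverts G) = n \<and> card (pverts H) = n \<and>
        wl_distinguishes k G colG H colH \<and>
        (\<forall>t::nat. real t < (2 powr (- real (c + 10)) * real k powr (- 3) * real n)
                             powr (real k / real (c + 1)) \<longrightarrow>
           \<not> wl_distinguishes_in (k + c - 1) t G colG H colH)"
      using copy(1-4) unfolding X_def by blast
  qed
qed

end
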